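(* Let $\rho\in\mathcal P(\mathbb R^d)$ satisfy $\lim_{r\to0}\mu_\rho(r)<\frac{1}{N(N-1)^2}$. Then $$C(\rho)=\max_{u\in\mathcal I_\rho}\Big\{N\int u\,d\rho\ :\ u(x_1)+\dots+u(x_N)\le c(x_1,\dots,x_N)\ \text{ for all }x_1,\dots,x_N\in\mathbb R^d\Big\},$$ and in particular the maximum is attained. Moreover, if $\beta>0$ is such that $\mu_\rho(\beta)<\frac{1}{N(N-1)^2}$, then whenever $0<\alpha\le\phi^{-1}\big(\frac{N^2(N-1)}{2}\phi(\beta)\big)$, any Kantorovich potential $u_\alpha$ for $C_\alpha$ is also a Kantorovich potential for $C$.
   Context: $d\ge1$ and $N>1$ are integers; $\mathcal P(X)$ is the set of Borel probability measures on $X$. The function $\phi:(0,+\infty)\to[0,+\infty)$ is continuous, strictly decreasing, and $\lim_{t\to0^+}\phi(t)=+\infty$; by convention $\phi(0)=+\infty$. The cost is $c(x_1,\dots,x_N)=\sum_{1\le i<j\le N}\phi(|x_i-x_j|)$ for $x_1,\dots,x_N\in\mathbb R^d$. For $\alpha>0$ the truncated cost is $c_\alpha(x_1,\dots,x_N)=\sum_{1\le i<j\le N}\min\{\phi(|x_i-x_j|),\phi(\alpha)\}$. $\Pi(\rho)$ is the set of $P\in\mathcal P(\mathbb R^{Nd})$ all of whose $N$ marginals on the factors $\mathbb R^d$ are equal to $\rho$. Set $C(\rho)=\min_{P\in\Pi(\rho)}\int c\,dP$ and $C_\alpha(\rho)=\min_{P\in\Pi(\rho)}\int c_\alpha\,dP$.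 Measure of concentration: $\mu_\rho(r)=\sup_{x\in\mathbb R^d}\rho(B(x,r))$, with $B(x,r)$ the open ball. $\mathcal I_\rho$ is the set of $\rho$-integrable functions $u:\mathbb R^d\to\mathbb R$. A Kantorovich potential for $C$ (for the given $\rho$) is a maximizer of $N\int u\,d\rho$ among $u\in\mathcal I_\rho$ satisfying $u(x_1)+\dots+u(x_N)\le c(x_1,\dots,x_N)$ everywhere; a Kantorovich potential for $C_\alpha$ is defined in the same way with $c_\alpha$ in place of $c$. *)

theory Defs
  imports "HOL-Probability.Probability"
begin

text \<open>The convention \<open>\<phi>(0) = +\<infinity>\<close>; only arguments \<open>t \<ge> 0\<close> matter.\<close>

definition ext0 :: "(real \<Rightarrow> real) \<Rightarrow> real \<Rightarrow> ennreal" where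
  "ext0 \<phi> t = (if t = 0 then \<infinity> else ennreal (\<phi> t))"

text \<open>A point of \<open>(\<real>\<^sup>d)\<^sup>N\<close> is a function on \<open>nat\<close> of which only the values on \<open>{1..N}\<close> are used.\<close>

definition pair_cost :: "(real \<Rightarrow> ennreal) \<Rightarrow> nat \<Rightarrow> (nat \<Rightarrow> 'a::euclidean_space) \<Rightarrow> ennreal" where
  "pair_cost f N x = (\<Sum>i\<in>{1..N}. \<Sum>j\<in>{i<..N}. f (norm (x i - x j)))"

definition cost :: "(real \<Rightarrow> real) \<Rightarrow> nat \<Rightarrow> (nat \<Rightarrow> 'a::euclidean_space) \<Rightarrow> ennreal" where
  "cost \<phi> = pair_cost (ext0 \<phi>)"

definition trunc_cost :: "(real \<Rightarrow> real) \<Rightarrow> real \<Rightarrow> nat \<Rightarrow> (nat \<Rightarrow> 'a::euclidean_space) \<Rightarrow> ennreal" where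
  "trunc_cost \<phi> \<alpha> = pair_cost (\<lambda>t. min (ext0 \<phi> t) (ext0 \<phi> \<alpha>))"

text \<open>\<open>\<Pi>(\<rho>)\<close>. For the finite index set \<open>{1..N}\<close> the product sigma-algebra of the Borel sigma-algebras
  is the Borel sigma-algebra of the product space.\<close>

definition plans :: "nat \<Rightarrow> 'a::euclidean_space measure \<Rightarrow> (nat \<Rightarrow> 'a) measure set" where
  "plans N \<rho> = {P. prob_space P \<and> sets P = sets (\<Pi>\<^sub>M i\<in>{1..N}. borel) \<and>
     (\<forall>i\<in>{1..N}. distr P borel (\<lambda>x. x i) = \<rho>)}"

text \<open>Defined as an infimum; that it is attained has to be stated separately.\<close>

definition transport_cost ::
    "nat \<Rightarrow> 'a::euclidean_space measure \<Rightarrow> ((nat \<Rightarrow> 'a) \<Rightarrow> ennreal) \<Rightarrow> ennreal" where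
  "transport_cost N \<rho> c = (INF P\<in>plans N \<rho>. \<integral>\<^sup>+x. c x \<partial>P)"

definition concentration :: "'a::euclidean_space measure \<Rightarrow> real \<Rightarrow> real" where
  "concentration \<rho> r = (SUP x. measure \<rho> (ball x r))"

text \<open>The left-hand side of the constraint may be negative and the cost may be infinite, so the
  two are compared in \<open>ereal\<close>.\<close>

definition dual_admissible ::
    "nat \<Rightarrow> 'a::euclidean_space measure \<Rightarrow> ((nat \<Rightarrow> 'a) \<Rightarrow> ennreal) \<Rightarrow> ('a \<Rightarrow> real) set" where
  "dual_admissible N \<rho> c =
     {u. integrable \<rho> u \<and> (\<forall>x. ereal (\<Sum>i\<in>{1..N}. u (x i)) \<le> enn2ereal (c x))}"

definition kantorovich_potential ::
    "nat \<Rightarrow> 'a::euclidean_space measure \<Rightarrow> ((nat \<Rightarrow> 'a) \<Rightarrow> ennreal) \<Rightarrow> ('a \<Rightarrow> real) \<Rightarrow> bool" where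
  "kantorovich_potential N \<rho> c u \<longleftrightarrow> u \<in> dual_admissible N \<rho> c \<and>
     (\<forall>v\<in>dual_admissible N \<rho> c. real N * (\<integral>x. v x \<partial>\<rho>) \<le> real N * (\<integral>x. u x \<partial>\<rho>))"

end

theory Submission
  imports Defs "HOL-Complex_Analysis.Great_Picard"
begin

text \<open>For the truncated cost, which is bounded and uniformly continuous, the dual problem is solved
  by an equicontinuous maximizing sequence obtained by sup-convolution. With \<open>D\<close> the dual value,
  the Hahn-Banach theorem yields a finitely additive coupling of cost at most \<open>D\<close>; its marginals
  are the tight measure \<open>\<rho>\<close>, so it extends to a countably additive plan, and there is no duality
  gap. By complementary slackness and the concentration bound, this plan lives on points whose
  coordinates are at distance at least \<open>\<alpha>\<close>, where the truncated and the original cost coincide;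
  hence both problems have the same value and a potential of the former is one of the latter.\<close>

subsection \<open>Sublinear functionals\<close>

text \<open>The original cost is infinite on the diagonals, hence neither bounded nor uniformly
  continuous. Truncation repairs both, at the price of the separation statement, which dictates the
  two constants. When N points of the good set are chosen one after another, a new point must avoid
  at most N - 1 earlier ones, for each of N(N-1) ordered pairs of distinct coordinates: at most
  N(N-1)^2 events, each of probability at most the concentration at \<beta>. The N points obtained
  by rotation cost at most N(N-1)/2 times \<open>\<phi> \<beta>\<close> each, together N^2(N-1)/2
  times \<open>\<phi> \<beta>\<close>, whereas a single pair closer than \<alpha> already costs
  \<open>\<phi> \<alpha>\<close>. The functional given by Hahn-Banach is only finitely additive and
  need not be integration against the plan extracted from it. Two facts suffice: both agree on
  cylinders, which fixes the marginals, and the plan gives an open set at most the mass that the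
  functional gives it. Superlevel sets of a continuous cost are open, so passing to the plan cannot
  raise the cost.\<close>

definition sublinear :: "('v::real_vector \<Rightarrow> real) \<Rightarrow> bool" where
  "sublinear q \<longleftrightarrow> (\<forall>x y. q (x + y) \<le> q x + q y) \<and> (\<forall>a x. a > 0 \<longrightarrow> q (a *\<^sub>R x) \<le> a * q x)"

lemma sublinear_add: "sublinear q \<Longrightarrow> q (x + y) \<le> q x + q y"
  by (simp add: sublinear_def)

lemma sublinear_zero:
  assumes "sublinear q" shows "q 0 = 0"
proof -
  have "q (2 *\<^sub>R 0) \<le> 2 * q 0" "q ((1/2) *\<^sub>R 0) \<le> (1/2) * q 0"
    using assms by (auto simp only: sublinear_def)
  then show ?thesis by simp
qed

lemma sublinear_neg:
  assumes "sublinear q" shows "- q (- x) \<le> q x"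
  using sublinear_add[OF assms, of x "- x"] sublinear_zero[OF assms] by simp

text \<open>The inequality assumed in \<open>sublinear\<close>, applied to \<open>inverse a\<close>,
  is the reverse one. Thus the definition can ask for one inequality only, the one that is easy to
  verify for infima.\<close>

lemma sublinear_scale:
  assumes "sublinear q" "a \<ge> 0" shows "q (a *\<^sub>R x) = a * q x"
proof (cases "a = 0")
  case False
  then have a: "a > 0" using assms by simp
  have 1: "q (a *\<^sub>R x) \<le> a * q x" using assms a by (auto simp: sublinear_def)
  have "q (inverse a *\<^sub>R (a *\<^sub>R x)) \<le> inverse a * q (a *\<^sub>R x)"
    using assms a unfolding sublinear_def by (metis positive_imp_inverse_positive)
  then have "a * q x \<le> q (a *\<^sub>R x)" using a by (simp add: field_simps)
  with 1 show ?thesis by simp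
qed (simp add: sublinear_zero[OF assms(1)])

text \<open>For a direction \<open>g\<close>, the infimum of
  \<open>q (y + t *\<^sub>R g) - t * q g\<close> over \<open>t \<ge> 0\<close> is sublinear in
  \<open>y\<close> and lies below \<open>q\<close>, so by minimality it is \<open>q\<close>. The
  member \<open>t = 1\<close> then reverses subadditivity.\<close>

lemma minimal_sublinear_linear:
  fixes q :: "'v::real_vector \<Rightarrow> real"
  assumes q: "sublinear q" and min: "\<And>r. sublinear r \<Longrightarrow> r \<le> q \<Longrightarrow> r = q"
  shows "linear q"
proof -
  have add: "q (x + g) = q x + q g" for x g
  proof -
    define r where "r y = (INF t\<in>{0..}. q (y + t *\<^sub>R g) - t * q g)" for y
    have low: "- q (- y) \<le> q (y + t *\<^sub>R g) - t * q g" if "t \<ge> 0" for y t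
      using sublinear_add[OF q, of "y + t *\<^sub>R g" "- y"] sublinear_scale[OF q that, of g] by simp
    have bdd: "bdd_below ((\<lambda>t. q (y + t *\<^sub>R g) - t * q g) ` {0..})" for y
      using low by (intro bdd_belowI2[where m = "- q (- y)"]) auto
    have r_le: "r y \<le> q (y + t *\<^sub>R g) - t * q g" if "t \<ge> 0" for y t
      unfolding r_def using that by (intro cINF_lower bdd) auto
    have r_ge: "m \<le> r y" if "\<And>t. t \<ge> 0 \<Longrightarrow> m \<le> q (y + t *\<^sub>R g) - t * q g" for m y
      unfolding r_def using that by (intro cINF_greatest) auto
    have "sublinear r"
      unfolding sublinear_def
    proof (intro conjI allI impI)
      fix y z
      have *: "r (y + z) \<le> (q (y + s *\<^sub>R g) - s * q g) + (q (z + t *\<^sub>R g) - t * q g)"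
        if "s \<ge> 0" "t \<ge> 0" for s t
      proof -
        have "r (y + z) \<le> q ((y + z) + (s + t) *\<^sub>R g) - (s + t) * q g"
          using that by (intro r_le) auto
        moreover have "(y + z) + (s + t) *\<^sub>R g = (y + s *\<^sub>R g) + (z + t *\<^sub>R g)"
          by (simp add: algebra_simps)
        ultimately show ?thesis
          using sublinear_add[OF q, of "y + s *\<^sub>R g" "z + t *\<^sub>R g"] by (simp add: algebra_simps)
      qed
      have "r (y + z) - (q (z + t *\<^sub>R g) - t * q g) \<le> r y" if "t \<ge> 0" for t
        using *[OF _ that] by (intro r_ge) (simp add: algebra_simps)
      then have "r (y + z) - r y \<le> r z"
        by (intro r_ge) (simp add: algebra_simps)
      then show "r (y + z) \<le> r y + r z" by simp
    next
      fix a :: real and y assume a: "a > 0"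
      have "r (a *\<^sub>R y) / a \<le> r y"
      proof (rule r_ge)
        fix t :: real assume t: "t \<ge> 0"
        have "r (a *\<^sub>R y) \<le> q (a *\<^sub>R y + (a * t) *\<^sub>R g) - (a * t) * q g"
          using a t by (intro r_le) auto
        also have "a *\<^sub>R y + (a * t) *\<^sub>R g = a *\<^sub>R (y + t *\<^sub>R g)" by (simp add: algebra_simps)
        also have "q \<dots> = a * q (y + t *\<^sub>R g)" using a by (intro sublinear_scale q) auto
        finally show "r (a *\<^sub>R y) / a \<le> q (y + t *\<^sub>R g) - t * q g"
          using a by (simp add: field_simps)
      qed
      then show "r (a *\<^sub>R y) \<le> a * r y" using a by (simp add: field_simps)
    qed
    moreover have "r \<le> q" using r_le[of 0] by (auto simp: le_fun_def)
    ultimately have "r = q" by (rule min)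
    then have "q x \<le> q (x + g) - q g" using r_le[of 1 x] by simp
    then show ?thesis using sublinear_add[OF q, of x g] by simp
  qed
  have neg: "q (- x) = - q x" for x
    using add[of x "- x"] sublinear_zero[OF q] by simp
  have "q (a *\<^sub>R x) = a *\<^sub>R q x" for a x
  proof (cases "a \<ge> 0")
    case False
    then have "q ((- a) *\<^sub>R x) = (- a) * q x" by (intro sublinear_scale q) auto
    then show ?thesis using neg[of "a *\<^sub>R x"] by simp
  qed (simp add: sublinear_scale[OF q])
  then show ?thesis by (intro linearI add) auto
qed

text \<open>Zorn's lemma for the reversed order gives a minimal sublinear functional below
  \<open>p\<close>. A chain is bounded below by its pointwise infimum, which is finite because every
  member is at least \<open>- p (- x)\<close> at \<open>x\<close>, and subadditive because any two
  members dominate a common one.\<close>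

lemma hahn_banach_sublinear:
  fixes p :: "'v::real_vector \<Rightarrow> real"
  assumes p: "sublinear p"
  obtains f where "linear f" "\<And>x. f x \<le> p x"
proof -
  define A where "A = {q. sublinear q \<and> q \<le> p}"
  have "\<exists>m\<in>A. \<forall>a\<in>A. m \<ge> a \<longrightarrow> a = m"
  proof (rule predicate_Zorn)
    show "partial_order_on A (relation_of (\<ge>) A)"
      by (auto simp: partial_order_on_def preorder_on_def refl_on_def trans_def antisym_def
          relation_of_def intro: order.trans)
  next
    fix C assume C: "C \<in> Chains (relation_of (\<ge>) A)"
    have CA: "C \<subseteq> A" and tot: "\<And>a b. a \<in> C \<Longrightarrow> b \<in> C \<Longrightarrow> a \<le> b \<or> b \<le> a"
      using C by (auto simp: Chains_def relation_of_def)
    show "\<exists>u\<in>A. \<forall>a\<in>C. a \<ge> u"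
    proof (cases "C = {}")
      case True
      then show ?thesis using p by (auto simp: A_def)
    next
      case False
      define u where "u x = (INF q\<in>C. q x)" for x
      have low: "- p (- x) \<le> q x" if "q \<in> C" for q x
      proof -
        have "sublinear q" "q (- x) \<le> p (- x)" using that CA by (auto simp: A_def le_fun_def)
        then show ?thesis using sublinear_neg[of q x] by simp
      qed
      have u_le: "u x \<le> q x" if "q \<in> C" for q x
        unfolding u_def using that low by (intro cINF_lower bdd_belowI2[where m = "- p (- x)"]) auto
      have u_ge: "m \<le> u x" if "\<And>q. q \<in> C \<Longrightarrow> m \<le> q x" for m x
        unfolding u_def using that False by (intro cINF_greatest) auto
      have "sublinear u"
        unfolding sublinear_def
      proof (intro conjI allI impI)
        fix x y
        have *: "u (x + y) \<le> q x + r y" if qr: "q \<in> C" "r \<in> C" for q r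
        proof -
          obtain s where s: "s \<in> C" "s \<le> q" "s \<le> r" using tot[OF qr] qr by auto
          have "u (x + y) \<le> s (x + y)" by (rule u_le) fact
          also have "\<dots> \<le> s x + s y" using s CA by (auto simp: A_def intro: sublinear_add)
          also have "\<dots> \<le> q x + r y" using s by (auto simp: le_fun_def intro: add_mono)
          finally show ?thesis .
        qed
        have "u (x + y) - r y \<le> u x" if "r \<in> C" for r
          using *[OF _ that] by (intro u_ge) (simp add: algebra_simps)
        then have "u (x + y) - u x \<le> u y" by (intro u_ge) (simp add: algebra_simps)
        then show "u (x + y) \<le> u x + u y" by simp
      next
        fix a :: real and x assume a: "a > 0"
        have "u (a *\<^sub>R x) / a \<le> u x"
        proof (rule u_ge)
          fix q assume q: "q \<in> C"
          then have "sublinear q" using CA by (auto simp: A_def)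
          then have "q (a *\<^sub>R x) = a * q x" using a by (intro sublinear_scale) auto
          then show "u (a *\<^sub>R x) / a \<le> q x" using u_le[OF q, of "a *\<^sub>R x"] a by (simp add: field_simps)
        qed
        then show "u (a *\<^sub>R x) \<le> a * u x" using a by (simp add: field_simps)
      qed
      moreover have "u \<le> p"
      proof -
        obtain q where q: "q \<in> C" using False by auto
        then have "q \<le> p" using CA by (auto simp: A_def)
        then show ?thesis using u_le[OF q] by (auto simp: le_fun_def intro: order.trans)
      qed
      ultimately show ?thesis using u_le by (intro bexI[of _ u]) (auto simp: A_def le_fun_def)
    qed
  qed
  then obtain m where m: "m \<in> A" "\<And>a. a \<in> A \<Longrightarrow> a \<le> m \<Longrightarrow> a = m" by auto
  have "linear m"
    using m by (intro minimal_sublinear_linear) (auto simp: A_def)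
  then show thesis using m(1) by (intro that[of m]) (auto simp: A_def le_fun_def)
qed

text \<open>Bounded functions do not form a type of class \<open>real_vector\<close>. Bounded
  continuous functions on the same set with the discrete topology do, and \<open>E\<close> and
  \<open>R\<close> translate between the two.\<close>

lemma hahn_banach_bounded:
  fixes p :: "('x \<Rightarrow> real) \<Rightarrow> real"
  assumes add: "\<And>f g. bounded (range f) \<Longrightarrow> bounded (range g) \<Longrightarrow> p (\<lambda>x. f x + g x) \<le> p f + p g"
    and scale: "\<And>a f. a > 0 \<Longrightarrow> bounded (range f) \<Longrightarrow> p (\<lambda>x. a * f x) \<le> a * p f"
  obtains L where
    "\<And>f g. bounded (range f) \<Longrightarrow> bounded (range g) \<Longrightarrow> L (\<lambda>x. f x + g x) = L f + L g"
    "\<And>a f. bounded (range f) \<Longrightarrow> L (\<lambda>x. a * f x) = a * L f"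
    "\<And>f. bounded (range f) \<Longrightarrow> L f \<le> p f"
proof -
  define R :: "('x discrete \<Rightarrow>\<^sub>C real) \<Rightarrow> 'x \<Rightarrow> real" where "R F x = apply_bcontfun F (discrete x)" for F x
  define E :: "('x \<Rightarrow> real) \<Rightarrow> ('x discrete \<Rightarrow>\<^sub>C real)" where "E f = Bcontfun (\<lambda>d. f (of_discrete d))" for f
  have [simp]: "bounded (range (R F))" for F
    using bounded_apply_bcontfun[of F] by (rule bounded_subset) (auto simp: R_def)
  have E: "apply_bcontfun (E f) d = f (of_discrete d)" if "bounded (range f)" for f d
  proof -
    have "bounded (range (\<lambda>d::'x discrete. f (of_discrete d)))"
      using that by (rule bounded_subset) auto
    moreover have "continuous_on UNIV (\<lambda>d::'x discrete. f (of_discrete d))"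
      by (simp add: continuous_on_open_vimage open_discrete)
    ultimately have "(\<lambda>d. f (of_discrete d)) \<in> bcontfun" by (simp add: bcontfun_def)
    then show ?thesis by (simp add: E_def Bcontfun_inverse)
  qed
  have RE: "R (E f) = f" if "bounded (range f)" for f
    using E[OF that] by (auto simp: R_def discrete_inverse)
  have R_add: "R (F + G) = (\<lambda>x. R F x + R G x)" for F G by (auto simp: R_def)
  have R_scale: "R (a *\<^sub>R F) = (\<lambda>x. a * R F x)" for a F by (auto simp: R_def)
  have "sublinear (\<lambda>F. p (R F))"
    using add scale by (auto simp: sublinear_def R_add R_scale)
  then obtain l where l: "linear l" "\<And>F. l F \<le> p (R F)"
    using hahn_banach_sublinear by blast
  show thesis
  proof (rule that[of "\<lambda>f. l (E f)"])
    fix f g :: "'x \<Rightarrow> real" assume fg: "bounded (range f)" "bounded (range g)"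
    have "bounded (range (\<lambda>x. f x + g x))" using fg by (rule bounded_plus_comp)
    then have "E (\<lambda>x. f x + g x) = E f + E g"
      using fg by (intro bcontfun_eqI) (simp add: E)
    then show "l (E (\<lambda>x. f x + g x)) = l (E f) + l (E g)" using l(1) by (simp add: linear_add)
  next
    fix a :: real and f :: "'x \<Rightarrow> real" assume f: "bounded (range f)"
    have "bounded (range (\<lambda>x. a * f x))" 
      using bounded_scaling[OF f, of a] by (simp add: image_image)
    then have "E (\<lambda>x. a * f x) = a *\<^sub>R E f"
      using f by (intro bcontfun_eqI) (simp add: E)
    then show "l (E (\<lambda>x. a * f x)) = a * l (E f)" using l(1) by (simp add: linear_scale)
  next
    fix f :: "'x \<Rightarrow> real" assume "bounded (range f)"
    then show "l (E f) \<le> p f" using l(2)[of "E f"] by (simp add: RE)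
  qed
qed

subsection \<open>Extension of finitely additive set functions\<close>

text \<open>Every subset of \<open>X\<close> has a mass, since \<open>m\<close> will come from a
  functional on all bounded functions. What has to be found is a family of sets on which
  \<open>m\<close> is countably additive.\<close>

locale finitely_additive =
  fixes X :: "'x::t2_space set" and m :: "'x set \<Rightarrow> real"
  assumes m_nonneg: "A \<subseteq> X \<Longrightarrow> 0 \<le> m A"
    and m_Un: "A \<subseteq> X \<Longrightarrow> B \<subseteq> X \<Longrightarrow> A \<inter> B = {} \<Longrightarrow> m (A \<union> B) = m A + m B"
    and tight: "e > 0 \<Longrightarrow> \<exists>K. compact K \<and> K \<subseteq> X \<and> m (X - K) < e"
begin

text \<open>The sets whose measure is exhausted by compact sets from inside and from outside form an
  algebra, and on it compactness makes \<open>m\<close> continuous at the empty set.\<close>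

definition compact_approx :: "'x set set" where
  "compact_approx = {E. E \<subseteq> X \<and> (\<forall>e>0. \<exists>K K'. compact K \<and> compact K' \<and> K \<subseteq> E \<and> K' \<subseteq> X - E \<and>
     m (X - (K \<union> K')) < e)}"

lemma m_empty: "m {} = 0"
  using m_Un[of "{}" "{}"] by simp

lemma m_mono: "A \<subseteq> B \<Longrightarrow> B \<subseteq> X \<Longrightarrow> m A \<le> m B"
proof -
  assume AB: "A \<subseteq> B" "B \<subseteq> X"
  then have "B = A \<union> (B - A)" "A \<subseteq> X" "B - A \<subseteq> X" by auto
  then show ?thesis using m_Un[of A "B - A"] m_nonneg[of "B - A"] by auto
qed

lemma m_subadd: "A \<subseteq> X \<Longrightarrow> B \<subseteq> X \<Longrightarrow> m (A \<union> B) \<le> m A + m B"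
proof -
  assume AB: "A \<subseteq> X" "B \<subseteq> X"
  then have "A \<union> B = A \<union> (B - A)" "B - A \<subseteq> X" by auto
  then show ?thesis using AB m_Un[of A "B - A"] m_mono[of "B - A" B] by auto
qed

lemma m_subadd_finite:
  assumes "finite I" "\<And>i. i \<in> I \<Longrightarrow> A i \<subseteq> X"
  shows "m (\<Union>i\<in>I. A i) \<le> (\<Sum>i\<in>I. m (A i))"
  using assms
proof (induction I)
  case (insert i I)
  then have "m (A i \<union> (\<Union>i\<in>I. A i)) \<le> m (A i) + m (\<Union>i\<in>I. A i)"
    by (intro m_subadd) auto
  with insert show ?case by simp
qed (simp add: m_empty)

lemma compact_approxD:
  assumes "E \<in> compact_approx" "e > 0"
  obtains K where "compact K" "K \<subseteq> E" "m (E - K) < e"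
proof -
  obtain K K' where K: "compact K" "K \<subseteq> E" "K' \<subseteq> X - E" "m (X - (K \<union> K')) < e" "E \<subseteq> X"
    using assms unfolding compact_approx_def by blast
  then have "m (E - K) \<le> m (X - (K \<union> K'))" by (intro m_mono) auto
  with K show thesis by (intro that[of K]) auto
qed

text \<open>A complement exchanges the inner and the outer compact set; a union takes the union of
  the inner and the intersection of the outer ones, and the part left over is covered by the two
  parts left over before.\<close>

lemma algebra_compact_approx: "algebra X compact_approx"
  unfolding algebra_iff_Un
proof (intro conjI ballI)
  show "compact_approx \<subseteq> Pow X" by (auto simp: compact_approx_def)
  show "{} \<in> compact_approx"
    unfolding compact_approx_def
  proof (intro CollectI conjI allI impI)
    fix e :: real assume "e > 0"
    from tight[OF this] obtain K where "compact K" "K \<subseteq> X" "m (X - K) < e" by blast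
    then show "\<exists>K K'. compact K \<and> compact K' \<and> K \<subseteq> {} \<and> K' \<subseteq> X - {} \<and> m (X - (K \<union> K')) < e"
      by (intro exI[of _ "{}"] exI[of _ K]) auto
  qed auto
  fix E assume E: "E \<in> compact_approx"
  show "X - E \<in> compact_approx"
    unfolding compact_approx_def
  proof (safe)
    fix e :: real assume "e > 0"
    with E obtain K K' where K: "compact K" "compact K'" "K \<subseteq> E" "K' \<subseteq> X - E" "m (X - (K \<union> K')) < e" "E \<subseteq> X"
      unfolding compact_approx_def by blast
    then show "\<exists>K K'. compact K \<and> compact K' \<and> K \<subseteq> X - E \<and> K' \<subseteq> X - (X - E) \<and> m (X - (K \<union> K')) < e"
      by (intro exI[of _ K'] exI[of _ K]) (auto simp: Un_commute)
  qed
  fix F assume F: "F \<in> compact_approx"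
  show "E \<union> F \<in> compact_approx"
    unfolding compact_approx_def
  proof (intro CollectI conjI allI impI)
    show EF: "E \<union> F \<subseteq> X" using E F by (auto simp: compact_approx_def)
    fix e :: real assume "e > 0"
    then have "e / 2 > 0" by simp
    with E obtain K K' where K: "compact K" "compact K'" "K \<subseteq> E" "K' \<subseteq> X - E" "m (X - (K \<union> K')) < e/2"
      unfolding compact_approx_def by blast
    from F \<open>e / 2 > 0\<close> obtain H H' where H: "compact H" "compact H'" "H \<subseteq> F" "H' \<subseteq> X - F" "m (X - (H \<union> H')) < e/2"
      unfolding compact_approx_def by blast
    have "m (X - (K \<union> H \<union> (K' \<inter> H'))) \<le> m ((X - (K \<union> K')) \<union> (X - (H \<union> H')))"
      by (intro m_mono) auto
    also have "\<dots> \<le> m (X - (K \<union> K')) + m (X - (H \<union> H'))" by (intro m_subadd) auto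
    also have "\<dots> < e" using K H by simp
    finally show "\<exists>K K'. compact K \<and> compact K' \<and> K \<subseteq> E \<union> F \<and> K' \<subseteq> X - (E \<union> F) \<and> m (X - (K \<union> K')) < e"
      using K H by (intro exI[of _ "K \<union> H"] exI[of _ "K' \<inter> H'"] conjI compact_Un compact_Int) auto
  qed
qed

text \<open>Choose compact \<open>C i\<close> inside \<open>A i\<close> missing mass less than
  \<open>e / 2 ^ (i + 1)\<close>. The \<open>C i\<close> have empty intersection, so by compactness
  finitely many of them already do; from then on \<open>A i\<close> is covered by the missing parts,
  of total mass below \<open>e\<close>.\<close>

lemma continuous_at_empty:
  assumes A: "range A \<subseteq> compact_approx" "decseq A" "(\<Inter>i. A i) = {}"
  shows "(\<lambda>i. m (A i)) \<longlonglongrightarrow> 0"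
proof (rule LIMSEQ_I)
  fix e :: real assume e: "e > 0"
  have sub: "A i \<subseteq> X" for i using A by (auto simp: compact_approx_def)
  have geo: "(\<Sum>k\<le>n. (1/2::real) ^ Suc k) = 1 - (1/2) ^ Suc n" for n
    by (induction n) simp_all
  have "\<exists>K. compact K \<and> K \<subseteq> A i \<and> m (A i - K) < e * (1/2) ^ Suc i" for i
  proof -
    have "A i \<in> compact_approx" "e * (1/2) ^ Suc i > 0" using A(1) e by auto
    then show ?thesis by (metis compact_approxD)
  qed
  then obtain C where C: "\<And>i. compact (C i)" "\<And>i. C i \<subseteq> A i" "\<And>i. m (A i - C i) < e * (1/2) ^ Suc i"
    by metis
  have "\<exists>n. (\<Inter>k\<le>n. C k) = {}"
  proof (rule ccontr)
    assume *: "\<nexists>n. (\<Inter>k\<le>n. C k) = {}"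
    have "C 0 \<inter> (\<Inter>i. C i) \<noteq> {}"
    proof (rule compact_imp_fip_image)
      fix I :: "nat set" assume "finite I"
      then obtain n where n: "I \<subseteq> {..n}" by (metis finite_nat_iff_bounded_le)
      have "(\<Inter>k\<le>n. C k) \<subseteq> C 0 \<inter> (\<Inter>i\<in>I. C i)" using n by auto
      with * show "C 0 \<inter> (\<Inter>i\<in>I. C i) \<noteq> {}" by (metis subset_empty)
    qed (auto intro: C compact_imp_closed)
    then show False using A(3) C(2) by blast
  qed
  then obtain n where n: "(\<Inter>k\<le>n. C k) = {}" by auto
  have "m (A i) < e" if "i \<ge> n" for i
  proof -
    have "A i \<subseteq> A k" if "k \<le> n" for k using \<open>i \<ge> n\<close> that A(2) by (auto simp: decseq_def)
    moreover have "\<exists>k\<le>n. x \<notin> C k" for x using n by auto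
    ultimately have "A i \<subseteq> (\<Union>k\<in>{..n}. A k - C k)" by fastforce
    then have "m (A i) \<le> m (\<Union>k\<in>{..n}. A k - C k)" using sub by (intro m_mono) auto
    also have "\<dots> \<le> (\<Sum>k\<in>{..n}. m (A k - C k))" using sub by (intro m_subadd_finite) auto
    also have "\<dots> \<le> (\<Sum>k\<in>{..n}. e * (1/2) ^ Suc k)" by (rule sum_mono, rule less_imp_le, rule C(3))
    also have "\<dots> = e * (1 - (1/2) ^ Suc n)"
      unfolding sum_distrib_left[symmetric] geo ..
    also have "\<dots> < e * 1" using e by (intro mult_strict_left_mono) auto
    finally show ?thesis by simp
  qed
  then show "\<exists>n. \<forall>i\<ge>n. norm (m (A i) - 0) < e" using m_nonneg[OF sub] by auto
qed

text \<open>Caratheodory's theorem applies by \<open>continuous_at_empty\<close>. Outside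
  \<open>compact_approx\<close> the measure and \<open>m\<close> may differ.\<close>

lemma extension:
  obtains P where "space P = X" "compact_approx \<subseteq> sets P" "\<And>E. E \<in> compact_approx \<Longrightarrow> emeasure P E = ennreal (m E)"
proof -
  interpret algebra X compact_approx by (rule algebra_compact_approx)
  have sub: "E \<subseteq> X" if "E \<in> compact_approx" for E using that by (auto simp: compact_approx_def)
  have "\<exists>\<mu>. (\<forall>s\<in>compact_approx. \<mu> s = ennreal (m s)) \<and> measure_space X (sigma_sets X compact_approx) \<mu>"
  proof (rule caratheodory_empty_continuous)
    show "positive compact_approx (\<lambda>E. ennreal (m E))" by (simp add: positive_def m_empty)
    show "additive compact_approx (\<lambda>E. ennreal (m E))"
      using sub m_nonneg by (auto simp: additive_def m_Un)
    show "(\<lambda>i. ennreal (m (A i))) \<longlonglongrightarrow> 0"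
      if "range A \<subseteq> compact_approx" "decseq A" "(\<Inter>i. A i) = {}" for A
      using tendsto_ennrealI[OF continuous_at_empty[OF that]] by simp
  qed auto
  then obtain \<mu> where \<mu>: "\<And>s. s \<in> compact_approx \<Longrightarrow> \<mu> s = ennreal (m s)"
    "measure_space X (sigma_sets X compact_approx) \<mu>" by auto
  define P where "P = measure_of X compact_approx \<mu>"
  have "compact_approx \<subseteq> Pow X" using sub by auto
  show thesis
  proof (rule that[of P])
    show "space P = X" by (simp add: P_def \<open>compact_approx \<subseteq> Pow X\<close>)
    show "compact_approx \<subseteq> sets P"
      by (auto simp: P_def \<open>compact_approx \<subseteq> Pow X\<close>)
    fix E assume "E \<in> compact_approx"
    then show "emeasure P E = ennreal (m E)"
      using \<mu> \<open>compact_approx \<subseteq> Pow X\<close> emeasure_measure_of[OF P_def, of E]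
      by (simp add: measure_space_def P_def)
  qed
qed

end

subsection \<open>Dual attainment for symmetric costs\<close>

text \<open>\<open>d\<close> is a bounded pseudometric for which \<open>c\<close> is 1-Lipschitz,
  and \<open>d_small\<close> makes it compatible with the topology. It plays the role of a modulus
  of continuity, with a triangle inequality at hand for the sup-convolution.\<close>

locale symmetric_cost = prob_space \<rho>
  for \<rho> :: "'a::euclidean_space measure" +
  fixes N :: nat and c :: "(nat \<Rightarrow> 'a) \<Rightarrow> real" and d :: "'a \<Rightarrow> 'a \<Rightarrow> real" and M :: real
  assumes N: "N \<ge> 1"
    and sets_rho [measurable_cong]: "sets \<rho> = sets borel"
    and c_nonneg: "0 \<le> c x" and c_le: "c x \<le> M"
    and c_restrict: "c (restrict x {1..N}) = c x"
    and c_permute: "\<sigma> permutes {1..N} \<Longrightarrow> c (x \<circ> \<sigma>) = c x"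
    and c_continuous: "continuous_on UNIV c"
    and c_lipschitz: "c x \<le> c y + (\<Sum>i\<in>{1..N}. d (x i) (y i))"
    and d_refl: "d p p = 0" and d_commute: "d p q = d q p"
    and d_triangle: "d p r \<le> d p q + d q r" and d_le: "d p q \<le> M"
    and d_small: "e > 0 \<Longrightarrow> \<exists>\<delta>>0. \<forall>q. dist p q < \<delta> \<longrightarrow> d p q < e"
begin

definition admissible :: "('a \<Rightarrow> real) \<Rightarrow> bool" where
  "admissible u \<longleftrightarrow> integrable \<rho> u \<and> (\<forall>x. (\<Sum>i\<in>{1..N}. u (x i)) \<le> c x)"

lemma admissibleD: "admissible u \<Longrightarrow> (\<Sum>i\<in>{1..N}. u (x i)) \<le> c x"
  by (simp add: admissible_def)

text \<open>The constraint is tested at the diagonal point \<open>\<lambda>_. q\<close>. A bound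
  from below becomes available only after sup-convolution.\<close>

lemma admissible_le:
  assumes "admissible u" shows "u q \<le> M"
proof -
  have "N * u q \<le> M"
    using admissibleD[OF assms, of "\<lambda>_. q"] c_le[of "\<lambda>_. q"] by simp
  moreover have "M \<ge> 0" using c_nonneg c_le order.trans by blast
  moreover have "u q \<le> N * u q" if "u q \<ge> 0" using N that by (simp add: mult_le_cancel_right1)
  ultimately show ?thesis by (cases "u q \<ge> 0") linarith+
qed

text \<open>The sup-convolution of \<open>u\<close> with \<open>- d\<close> improves an admissible \<open>u\<close>, and its modulus of
  continuity does not depend on \<open>u\<close>.\<close>

definition sup_conv :: "('a \<Rightarrow> real) \<Rightarrow> 'a \<Rightarrow> real" where
  "sup_conv u p = (SUP q. u q - d p q)"

lemma d_nonneg: "0 \<le> d p q"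
  using d_triangle[of p p q] d_refl[of p] d_commute[of p q] by simp

context
  fixes u assumes u: "admissible u"
begin

lemma sup_conv_bdd: "bdd_above (range (\<lambda>q. u q - d p q))"
  using admissible_le[OF u] d_nonneg by (intro bdd_aboveI2[where M = M]) (smt (verit))

lemma sup_conv_upper: "u q - d p q \<le> sup_conv u p"
  unfolding sup_conv_def by (intro cSUP_upper sup_conv_bdd) auto

lemma sup_conv_ge: "u p \<le> sup_conv u p"
  using sup_conv_upper[of p p] by (simp add: d_refl)

lemma sup_conv_le: "(\<And>q. u q - d p q \<le> b) \<Longrightarrow> sup_conv u p \<le> b"
  unfolding sup_conv_def by (intro cSUP_least) auto

lemma sup_conv_lipschitz: "sup_conv u p \<le> sup_conv u p' + d p p'"
proof (rule sup_conv_le)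
  fix q show "u q - d p q \<le> sup_conv u p' + d p p'"
    using sup_conv_upper[of q p'] d_triangle[of p' q p] d_commute[of p p'] by simp
qed

text \<open>Replace each coordinate by a nearly optimal point of its supremum. The cost changes by
  at most the sum of the distances, and exactly this sum has been subtracted.\<close>

lemma sup_conv_sum_le: "(\<Sum>i\<in>{1..N}. sup_conv u (x i)) \<le> c x"
proof (rule field_le_epsilon)
  fix e :: real assume e: "e > 0"
  have "\<exists>q. sup_conv u p - e / N < u q - d p q" for p
    using less_cSUP_iff[OF _ sup_conv_bdd[of p], of "sup_conv u p - e / N"] e N
    by (auto simp: sup_conv_def)
  then obtain q where q: "\<And>p. sup_conv u p - e / N < u (q p) - d p (q p)" by metis
  have "(\<Sum>i\<in>{1..N}. sup_conv u (x i)) \<le> (\<Sum>i\<in>{1..N}. u (q (x i)) - d (x i) (q (x i)) + e / N)"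
    using q by (intro sum_mono) (smt (verit))
  also have "\<dots> = (\<Sum>i\<in>{1..N}. u (q (x i))) - (\<Sum>i\<in>{1..N}. d (q (x i)) (x i)) + e"
    using N by (simp add: sum.distrib sum_subtractf d_commute)
  also have "(\<Sum>i\<in>{1..N}. u (q (x i))) \<le> c (\<lambda>i. q (x i))"
    by (rule admissibleD[OF u])
  also have "\<dots> \<le> c x + (\<Sum>i\<in>{1..N}. d (q (x i)) (x i))" by (rule c_lipschitz)
  finally show "(\<Sum>i\<in>{1..N}. sup_conv u (x i)) \<le> c x + e" by simp
qed

lemma sup_conv_le_M: "sup_conv u p \<le> M"
proof (rule sup_conv_le)
  show "u q - d p q \<le> M" for q using admissible_le[OF u, of q] d_nonneg[of p q] by simp
qed

text \<open>Since \<open>d \<le> M\<close>, one value of \<open>u\<close> that is not too small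
  raises the sup-convolution everywhere.\<close>

lemma sup_conv_lower:
  assumes "u q \<ge> - 1" shows "\<bar>sup_conv u p\<bar> \<le> M + 1"
proof -
  have "- 1 - M \<le> sup_conv u p" using sup_conv_upper[of q p] assms d_le[of p q] by simp
  then show ?thesis using sup_conv_le_M[of p] by simp
qed

lemma sup_conv_measurable: "sup_conv u \<in> borel_measurable \<rho>"
proof -
  have "isCont (sup_conv u) p" for p
    unfolding continuous_at_eps_delta
  proof (intro allI impI)
    fix e :: real assume "e > 0"
    then obtain \<delta> where \<delta>: "\<delta> > 0" "\<And>q. dist p q < \<delta> \<Longrightarrow> d p q < e" using d_small by blast
    have "dist (sup_conv u q) (sup_conv u p) < e" if "dist q p < \<delta>" for q
      using \<delta>(2)[of q] that sup_conv_lipschitz[of p q] sup_conv_lipschitz[of q p] d_commute[of p q]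
      by (simp add: dist_real_def dist_commute)
    with \<delta>(1) show "\<exists>\<delta>>0. \<forall>q. dist q p < \<delta> \<longrightarrow> dist (sup_conv u q) (sup_conv u p) < e" by blast
  qed
  then have "sup_conv u \<in> borel_measurable borel"
    by (intro borel_measurable_continuous_onI continuous_at_imp_continuous_on) auto
  then show ?thesis by (simp add: measurable_cong_sets[OF sets_rho refl])
qed

end

lemma integral_le_M:
  assumes "admissible u" shows "(\<integral>x. u x \<partial>\<rho>) \<le> M"
  using integral_le_const[of u M] assms admissible_le[OF assms] by (auto simp: admissible_def)

text \<open>An Arzela-Ascoli argument: sup-convolution makes a maximizing sequence uniformly bounded
  with common modulus \<open>d\<close>, without lowering integrals. A subsequence converging on a
  countable dense set therefore converges everywhere, and dominated convergence carries the
  integrals to the limit.\<close>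

lemma dual_attained:
  obtains u where "admissible u" "\<And>v. admissible v \<Longrightarrow> (\<integral>x. v x \<partial>\<rho>) \<le> (\<integral>x. u x \<partial>\<rho>)"
proof -
  define I where "I = (\<lambda>v. \<integral>x. v x \<partial>\<rho>) ` Collect admissible"
  define D where "D = Sup I"
  have adm0: "admissible (\<lambda>_. 0)" using c_nonneg by (simp add: admissible_def)
  then have "I \<noteq> {}" "0 \<in> I" by (auto simp: I_def image_iff intro!: exI[of _ "\<lambda>_. 0"])
  have bdd: "bdd_above I" using integral_le_M by (auto simp: I_def intro!: bdd_aboveI2)
  have D_ge: "(\<integral>x. v x \<partial>\<rho>) \<le> D" if "admissible v" for v
    unfolding D_def using that by (intro cSup_upper bdd) (auto simp: I_def)
  have D0: "D \<ge> 0" using D_ge[OF adm0] by simp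
  have "\<exists>u. admissible u \<and> D - 1 / Suc n < (\<integral>x. u x \<partial>\<rho>)" for n
  proof -
    have "D - 1 / Suc n < Sup I" by (simp add: D_def)
    then show ?thesis
      unfolding less_cSup_iff[OF \<open>I \<noteq> {}\<close> bdd] by (auto simp: I_def)
  qed
  then obtain u where u: "\<And>n. admissible (u n)" "\<And>n::nat. D - 1 / Suc n < (\<integral>x. u n x \<partial>\<rho>)" by metis
  \<comment> \<open>Otherwise the integral would be at most -1, but it exceeds
    \<open>D - 1 / Suc n\<close>, which is at least -1.\<close>
  have u_lower: "\<exists>q. u n q \<ge> - 1" for n
  proof (rule ccontr)
    assume "\<nexists>q. u n q \<ge> - 1"
    then have "u n q \<le> - 1" for q by (meson linear)
    then have "(\<integral>x. u n x \<partial>\<rho>) \<le> - 1"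
      using u(1)[of n] by (intro integral_le_const) (auto simp: admissible_def)
    moreover have "1 / Suc n \<le> (1::real)" by simp
    ultimately show False using u(2)[of n] D0 by linarith
  qed
  define v where "v n = sup_conv (u n)" for n
  have v_bdd: "\<bar>v n p\<bar> \<le> M + 1" for n p
    using u_lower[of n] sup_conv_lower[OF u(1)] by (auto simp: v_def)
  have v_meas [measurable]: "v n \<in> borel_measurable \<rho>" for n
    unfolding v_def by (rule sup_conv_measurable[OF u(1)])
  have v_int: "integrable \<rho> (v n)" for n
    using v_bdd by (intro integrable_const_bound[where B = "M + 1"]) auto
  have v_lip: "\<bar>v n p - v n q\<bar> \<le> d p q" for n p q
    using sup_conv_lipschitz[OF u(1)[of n], of p q] sup_conv_lipschitz[OF u(1)[of n], of q p] d_commute[of p q]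
    by (simp add: v_def)
  obtain S :: "'a set" where S: "countable S" "\<And>X. open X \<Longrightarrow> X \<noteq> {} \<Longrightarrow> \<exists>s\<in>S. s \<in> X"
    using countable_dense_exists by metis
  obtain k where k: "strict_mono k" "\<And>x. x \<in> S \<Longrightarrow> \<exists>l. (\<lambda>n. v (k n) x) \<longlonglongrightarrow> l"
    using function_convergent_subsequence[OF S(1), of v "M + 1"] v_bdd by auto
  have "Cauchy (\<lambda>n. v (k n) p)" for p
  proof (rule metric_CauchyI)
    fix e :: real assume e: "e > 0"
    then obtain \<delta> where \<delta>: "\<delta> > 0" "\<And>q. dist p q < \<delta> \<Longrightarrow> d p q < e / 3"
      using d_small[of "e / 3" p] by auto
    obtain s where s: "s \<in> S" "s \<in> ball p \<delta>" using S(2)[of "ball p \<delta>"] \<delta>(1) by auto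
    have "Cauchy (\<lambda>n. v (k n) s)" using k(2)[OF s(1)] by (auto intro: LIMSEQ_imp_Cauchy)
    then obtain n0 where n0: "\<And>m n. m \<ge> n0 \<Longrightarrow> n \<ge> n0 \<Longrightarrow> dist (v (k m) s) (v (k n) s) < e / 3"
      using e by (meson metric_CauchyD zero_less_divide_iff zero_less_numeral)
    have "dist (v (k m) p) (v (k n) p) < e" if "m \<ge> n0" "n \<ge> n0" for m n
    proof -
      have "d p s < e / 3" using \<delta>(2) s(2) by simp
      then show ?thesis
        using n0[OF that] v_lip[of "k m" p s] v_lip[of "k n" p s] unfolding dist_real_def by linarith
    qed
    then show "\<exists>n0. \<forall>m\<ge>n0. \<forall>n\<ge>n0. dist (v (k m) p) (v (k n) p) < e" by blast
  qed
  then have "\<exists>l. (\<lambda>n. v (k n) p) \<longlonglongrightarrow> l" for p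
    by (meson Cauchy_convergent convergent_def)
  then obtain w where w: "\<And>p. (\<lambda>n. v (k n) p) \<longlonglongrightarrow> w p" by metis
  have w_meas [measurable]: "w \<in> borel_measurable \<rho>"
    using w by (rule borel_measurable_LIMSEQ_real) simp
  have int_lim: "integrable \<rho> w" "(\<lambda>n. \<integral>x. v (k n) x \<partial>\<rho>) \<longlonglongrightarrow> (\<integral>x. w x \<partial>\<rho>)"
    using w v_bdd
    by (auto intro!: integrable_dominated_convergence[where w = "\<lambda>_. M + 1" and s = "\<lambda>n. v (k n)"]
        integral_dominated_convergence[where w = "\<lambda>_. M + 1"])
  have "admissible w"
    unfolding admissible_def
  proof (intro conjI allI int_lim(1))
    fix x :: "nat \<Rightarrow> 'a"
    have "(\<lambda>n. \<Sum>i\<in>{1..N}. v (k n) (x i)) \<longlonglongrightarrow> (\<Sum>i\<in>{1..N}. w (x i))"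
      using w by (intro tendsto_sum)
    then show "(\<Sum>i\<in>{1..N}. w (x i)) \<le> c x"
      using sup_conv_sum_le[OF u(1)] by (intro LIMSEQ_le_const2) (auto simp: v_def)
  qed
  moreover have "D \<le> (\<integral>x. w x \<partial>\<rho>)"
  proof (rule LIMSEQ_le)
    show "(\<lambda>n. D - 1 / Suc (k n)) \<longlonglongrightarrow> D"
    proof -
      have "(\<lambda>n. D - 1 / Suc n) \<longlonglongrightarrow> D - 0"
        by (intro tendsto_diff tendsto_const LIMSEQ_Suc[OF lim_1_over_n])
      from LIMSEQ_subseq_LIMSEQ[OF this k(1)] show ?thesis by (simp add: o_def)
    qed
    show "(\<lambda>n. \<integral>x. v (k n) x \<partial>\<rho>) \<longlonglongrightarrow> (\<integral>x. w x \<partial>\<rho>)" by (rule int_lim(2))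
    have "D - 1 / Suc (k n) \<le> (\<integral>x. v (k n) x \<partial>\<rho>)" for n
    proof -
      have "(\<integral>x. u (k n) x \<partial>\<rho>) \<le> (\<integral>x. v (k n) x \<partial>\<rho>)"
        using u(1)[of "k n"] v_int sup_conv_ge[OF u(1)]
        by (intro integral_mono) (auto simp: admissible_def v_def)
      then show ?thesis using u(2)[of "k n"] by simp
    qed
    then show "\<exists>n0. \<forall>n\<ge>n0. D - 1 / Suc (k n) \<le> (\<integral>x. v (k n) x \<partial>\<rho>)" by blast
  qed
  ultimately show thesis using D_ge by (intro that[of w]) (auto intro: order.trans)
qed

end

subsection \<open>Absence of a duality gap\<close>

text \<open>The cyclic shift of \<open>{1..N}\<close> by \<open>r + 1\<close> places. The offset is
  harmless as \<open>r\<close> runs through all of \<open>{..<N}\<close>; outside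
  \<open>{1..N}\<close> it is the identity, as \<open>permutes\<close> demands.\<close>

definition rot :: "nat \<Rightarrow> nat \<Rightarrow> nat \<Rightarrow> nat" where
  "rot N r i = (if i \<in> {1..N} then (i + r) mod N + 1 else i)"

lemma mod_shift_cancel:
  fixes i j r N :: nat
  assumes "(i + r) mod N = (j + r) mod N" "i < j + N" "j < i + N"
  shows "i = j"
proof -
  have *: "i = j" if "(i + r) mod N = (j + r) mod N" "j \<le> i" "i < j + N" for i j :: nat
  proof -
    have "N dvd i - j" using that(1,2) mod_eq_dvd_iff_nat[of "j + r" "i + r" N] by auto
    with that(2,3) show ?thesis by (metis diff_is_0_eq dual_order.antisym dvd_imp_le leD le_add_diff_inverse
      nat_add_left_cancel_less neq0_conv)
  qed
  show ?thesis
    using *[of i j] *[of j i] assms by (cases "j \<le> i") auto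
qed

lemma rot_in: "i \<in> {1..N} \<Longrightarrow> rot N r i \<in> {1..N}"
  by (auto simp: rot_def Suc_le_eq)

lemma rot_permutes: "rot N r permutes {1..N}"
proof (rule bij_imp_permutes)
  have "inj_on (rot N r) {1..N}"
    by (rule inj_onI, rule mod_shift_cancel[of _ r N]) (auto simp: rot_def)
  moreover have "rot N r ` {1..N} \<subseteq> {1..N}" using rot_in by auto
  ultimately show "bij_betw (rot N r) {1..N} {1..N}"
    by (simp add: bij_betw_def endo_inj_surj)
qed (auto simp: rot_def)

lemma rot_bij_betw:
  assumes "i \<in> {1..N}" shows "bij_betw (\<lambda>r. rot N r i) {..<N} {1..N}"
proof -
  have inj: "inj_on (\<lambda>r. rot N r i) {..<N}"
    using assms by (intro inj_onI, rule_tac mod_shift_cancel[of _ i N]) (auto simp: rot_def add.commute)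
  moreover have "(\<lambda>r. rot N r i) ` {..<N} = {1..N}"
    using rot_in[OF assms] card_image[OF inj] by (intro card_subset_eq) auto
  ultimately show ?thesis by (simp add: bij_betw_def)
qed

text \<open>For fixed \<open>i\<close>, each \<open>j\<close> equals \<open>rot N r i\<close> for
  exactly one \<open>r\<close>. Hence N rotations do the work of averaging over all
  permutations.\<close>

lemma sum_rot:
  fixes f :: "nat \<Rightarrow> nat \<Rightarrow> real"
  shows "(\<Sum>r<N. \<Sum>i\<in>{1..N}. f i (rot N r i)) = (\<Sum>i\<in>{1..N}. \<Sum>j\<in>{1..N}. f i j)"
proof -
  have "(\<Sum>r<N. \<Sum>i\<in>{1..N}. f i (rot N r i)) = (\<Sum>i\<in>{1..N}. \<Sum>r<N. f i (rot N r i))"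
    by (rule sum.swap)
  also have "\<dots> = (\<Sum>i\<in>{1..N}. \<Sum>j\<in>{1..N}. f i j)"
    by (intro sum.cong refl sum.reindex_bij_betw rot_bij_betw)
  finally show ?thesis .
qed

lemma inner_approx:
  fixes \<rho> :: "'a::euclidean_space measure"
  assumes "finite_measure \<rho>" "sets \<rho> = sets borel" "B \<in> sets borel" "e > 0"
  obtains H where "compact H" "H \<subseteq> B" "measure \<rho> (B - H) < e"
\<comment> \<open>In the second case \<open>measure \<rho> B - e\<close> is nonnegative, so
  \<open>ennreal\<close> does not cut it off at 0.\<close>
proof (cases "measure \<rho> B < e")
  case True
  then show thesis by (intro that[of "{}"]) auto
next
  case False
  interpret finite_measure \<rho> by fact
  have "ennreal (measure \<rho> B - e) < emeasure \<rho> B"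
    using assms(4) False by (simp add: emeasure_eq_measure ennreal_less_iff)
  also have "\<dots> = (SUP K \<in> {K. K \<subseteq> B \<and> compact K}. emeasure \<rho> K)"
    using assms by (intro inner_regular) auto
  finally obtain H where H: "H \<subseteq> B" "compact H" "ennreal (measure \<rho> B - e) < emeasure \<rho> H"
    by (auto simp: less_SUP_iff)
  have "measure \<rho> B - e < measure \<rho> H"
    using H(3) False by (simp add: emeasure_eq_measure ennreal_less_iff)
  moreover have "measure \<rho> (B - H) = measure \<rho> B - measure \<rho> H"
    using H assms by (intro finite_measure_Diff) (auto simp: compact_imp_closed)
  ultimately show thesis using H by (intro that[of H]) auto
qed

text \<open>A discrete layer-cake formula with step \<open>h\<close>. It will compare the integral
  of the cost with the value of the functional through superlevel sets alone.\<close>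

lemma layer_bounds:
  fixes y h :: real
  assumes "y \<ge> 0" "h \<ge> 0"
  shows "(\<Sum>k\<in>{1..n}. h * of_bool (real k * h < y)) \<le> min y (n * h)"
    and "min y (Suc n * h) \<le> h + (\<Sum>k\<in>{1..n}. h * of_bool (real k * h < y))"
proof -
  have "(\<Sum>k\<in>{1..n}. h * of_bool (real k * h < y)) \<le> min y (n * h) \<and>
    min y (Suc n * h) \<le> h + (\<Sum>k\<in>{1..n}. h * of_bool (real k * h < y))"
  proof (induction n)
    case (Suc n)
    show ?case
    proof (cases "real (Suc n) * h < y")
      case True
      then show ?thesis using Suc assms by (auto simp: algebra_simps min_def split: if_splits)
    next
      case False
      then show ?thesis using Suc assms by (auto simp: algebra_simps min_def split: if_splits)
    qed
  qed (use assms in auto)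
  then show "(\<Sum>k\<in>{1..n}. h * of_bool (real k * h < y)) \<le> min y (n * h)"
    and "min y (Suc n * h) \<le> h + (\<Sum>k\<in>{1..n}. h * of_bool (real k * h < y))" by auto
qed

section \<open>A linear functional dominated by the covers\<close>

context symmetric_cost
begin

text \<open>This is the space of the product measure and at the same time a subset of a function
  space with the product topology, in which compactness is meant.\<close>

definition X :: "(nat \<Rightarrow> 'a) set" where "X = {1..N} \<rightarrow>\<^sub>E UNIV"

text \<open>The infimum of \<open>covers D f\<close> is sublinear in \<open>f\<close>. A linear functional below it has marginals
  \<open>\<rho>\<close> (because of the terms \<open>u i\<close>) and maps \<open>c\<close> to at most \<open>D\<close> (because of the term \<open>t * D\<close>).\<close>

definition covers :: "real \<Rightarrow> ((nat \<Rightarrow> 'a) \<Rightarrow> real) \<Rightarrow> real set" where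
  "covers D f = {(\<Sum>i\<in>{1..N}. \<integral>x. u i x \<partial>\<rho>) + t * D | u t. t \<ge> 0 \<and> (\<forall>i\<in>{1..N}. integrable \<rho> (u i)) \<and>
     (\<forall>x\<in>X. f x \<le> (\<Sum>i\<in>{1..N}. u i (x i)) + t * c x)}"

lemma coversI:
  assumes "t \<ge> 0" "\<And>i. i \<in> {1..N} \<Longrightarrow> integrable \<rho> (u i)"
    "\<And>x. x \<in> X \<Longrightarrow> f x \<le> (\<Sum>i\<in>{1..N}. u i (x i)) + t * c x"
    "s = (\<Sum>i\<in>{1..N}. \<integral>x. u i x \<partial>\<rho>) + t * D"
  shows "s \<in> covers D f"
  unfolding covers_def using assms by blast

lemma coversE:
  assumes "s \<in> covers D f"
  obtains u t where "t \<ge> 0" "\<And>i. i \<in> {1..N} \<Longrightarrow> integrable \<rho> (u i)"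
    "\<And>x. x \<in> X \<Longrightarrow> f x \<le> (\<Sum>i\<in>{1..N}. u i (x i)) + t * c x"
    "s = (\<Sum>i\<in>{1..N}. \<integral>x. u i x \<partial>\<rho>) + t * D"
  using assms unfolding covers_def by blast

lemma covers_add:
  assumes "s \<in> covers D f" "s' \<in> covers D g"
  shows "s + s' \<in> covers D (\<lambda>x. f x + g x)"
proof -
  from assms(1) obtain u t where u: "t \<ge> 0" "\<And>i. i \<in> {1..N} \<Longrightarrow> integrable \<rho> (u i)"
    "\<And>x. x \<in> X \<Longrightarrow> f x \<le> (\<Sum>i\<in>{1..N}. u i (x i)) + t * c x"
    "s = (\<Sum>i\<in>{1..N}. \<integral>x. u i x \<partial>\<rho>) + t * D" by (rule coversE) blast
  from assms(2) obtain v t' where v: "t' \<ge> 0" "\<And>i. i \<in> {1..N} \<Longrightarrow> integrable \<rho> (v i)"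
    "\<And>x. x \<in> X \<Longrightarrow> g x \<le> (\<Sum>i\<in>{1..N}. v i (x i)) + t' * c x"
    "s' = (\<Sum>i\<in>{1..N}. \<integral>x. v i x \<partial>\<rho>) + t' * D" by (rule coversE) blast
  show ?thesis
  proof (rule coversI[where t = "t + t'" and u = "\<lambda>i x. u i x + v i x"])
    fix x assume "x \<in> X"
    then show "f x + g x \<le> (\<Sum>i\<in>{1..N}. u i (x i) + v i (x i)) + (t + t') * c x"
      using u(3)[of x] v(3)[of x] by (simp add: sum.distrib algebra_simps)
  next
    show "s + s' = (\<Sum>i\<in>{1..N}. \<integral>x. u i x + v i x \<partial>\<rho>) + (t + t') * D"
      using u(2,4) v(2,4) by (simp add: sum.distrib algebra_simps)
  qed (use u v in auto)
qed

lemma covers_scale: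
  assumes "s \<in> covers D f" "a > 0"
  shows "a * s \<in> covers D (\<lambda>x. a * f x)"
proof -
  from assms(1) obtain u t where u: "t \<ge> 0" "\<And>i. i \<in> {1..N} \<Longrightarrow> integrable \<rho> (u i)"
    "\<And>x. x \<in> X \<Longrightarrow> f x \<le> (\<Sum>i\<in>{1..N}. u i (x i)) + t * c x"
    "s = (\<Sum>i\<in>{1..N}. \<integral>x. u i x \<partial>\<rho>) + t * D" by (rule coversE) blast
  show ?thesis
  proof (rule coversI[where t = "a * t" and u = "\<lambda>i x. a * u i x"])
    fix x assume "x \<in> X"
    then have "a * f x \<le> a * ((\<Sum>i\<in>{1..N}. u i (x i)) + t * c x)"
      using u(3)[of x] assms(2) by simp
    then show "a * f x \<le> (\<Sum>i\<in>{1..N}. a * u i (x i)) + (a * t) * c x"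
      by (simp add: sum_distrib_left algebra_simps)
  next
    show "a * s = (\<Sum>i\<in>{1..N}. \<integral>x. a * u i x \<partial>\<rho>) + (a * t) * D"
      using u(4) by (simp add: sum_distrib_left algebra_simps)
  qed (use u assms in auto)
qed

lemma covers_const:
  assumes "\<And>x. x \<in> X \<Longrightarrow> f x \<le> K"
  shows "K \<in> covers D f"
  using assms N by (intro coversI[where t = 0 and u = "\<lambda>_ _. K / N"]) (auto simp: prob_space)

text \<open>Averaging over the cyclic rotations of the coordinates replaces the functions \<open>u i\<close>
  by their mean, which is a multiple of an admissible function.\<close>

lemma covers_zero:
  assumes D: "\<And>v. admissible v \<Longrightarrow> N * (\<integral>x. v x \<partial>\<rho>) \<le> D"
    and s: "s \<in> covers D (\<lambda>_. 0)"
  shows "0 \<le> s"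
proof -
  from s obtain u t where u: "t \<ge> 0" "\<And>i. i \<in> {1..N} \<Longrightarrow> integrable \<rho> (u i)"
    "\<And>x. x \<in> X \<Longrightarrow> 0 \<le> (\<Sum>i\<in>{1..N}. u i (x i)) + t * c x"
    "s = (\<Sum>i\<in>{1..N}. \<integral>x. u i x \<partial>\<rho>) + t * D" by (rule coversE) blast
  define w where "w y = (\<Sum>i\<in>{1..N}. u i y) / N" for y
  have w_int: "integrable \<rho> w" 
    unfolding w_def by (intro integrable_divide_zero Bochner_Integration.integrable_sum u(2))
  have w_sum: "N * (\<integral>x. w x \<partial>\<rho>) = (\<Sum>i\<in>{1..N}. \<integral>x. u i x \<partial>\<rho>)"
    unfolding w_def using u(2) N by (subst integral_divide_zero, subst Bochner_Integration.integral_sum) auto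
  have pos: "0 \<le> (\<Sum>i\<in>{1..N}. u i (x i)) + t * c x" for x
  proof -
    have "restrict x {1..N} \<in> X" by (auto simp: X_def)
    from u(3)[OF this] show ?thesis unfolding c_restrict by simp
  qed
  have w_pos: "0 \<le> (\<Sum>i\<in>{1..N}. w (x i)) + t * c x" for x
  proof -
    have "0 \<le> (\<Sum>r<N. (\<Sum>i\<in>{1..N}. u i (x (rot N r i))) + t * c x)"
      using pos[of "x \<circ> rot N r" for r] c_permute[OF rot_permutes, of x]
      by (intro sum_nonneg) simp
    also have "\<dots> = (\<Sum>r<N. \<Sum>i\<in>{1..N}. u i (x (rot N r i))) + N * (t * c x)"
      by (simp add: sum.distrib)
    also have "(\<Sum>r<N. \<Sum>i\<in>{1..N}. u i (x (rot N r i))) = (\<Sum>i\<in>{1..N}. \<Sum>j\<in>{1..N}. u i (x j))"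
      by (rule sum_rot[where f = "\<lambda>i j. u i (x j)"])
    also have "\<dots> = (\<Sum>j\<in>{1..N}. \<Sum>i\<in>{1..N}. u i (x j))" by (rule sum.swap)
    also have "\<dots> = N * (\<Sum>j\<in>{1..N}. w (x j))"
      using N by (simp add: w_def sum_divide_distrib[symmetric])
    finally have "0 \<le> N * ((\<Sum>i\<in>{1..N}. w (x i)) + t * c x)" by (simp add: algebra_simps)
    then show ?thesis using N by (simp add: zero_le_mult_iff)
  qed
  \<comment> \<open>For \<open>t = 0\<close> the diagonal points show that \<open>w\<close> is
    nonnegative. For \<open>t > 0\<close> the function \<open>- w / t\<close> is admissible, and the
    hypothesis on \<open>D\<close> applies to it.\<close>
  show ?thesis
  proof (cases "t = 0")
    case True
    have "0 \<le> w y" for y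
      using w_pos[of "\<lambda>_. y"] True N by (simp add: zero_le_mult_iff)
    then have "0 \<le> (\<integral>x. w x \<partial>\<rho>)" by (intro integral_nonneg_AE) auto
    then show ?thesis using True u(4) w_sum by (metis add.right_neutral mult_nonneg_nonneg mult_zero_left of_nat_0_le_iff)
  next
    case False
    with u(1) have t: "t > 0" by simp
    have "admissible (\<lambda>y. - w y / t)"
      unfolding admissible_def
    proof (intro conjI allI)
      fix x :: "nat \<Rightarrow> 'a"
      have "(\<Sum>i\<in>{1..N}. - w (x i) / t) = - (\<Sum>i\<in>{1..N}. w (x i)) / t"
        by (simp add: sum_divide_distrib[symmetric] sum_negf)
      also have "\<dots> \<le> c x" using w_pos[of x] t by (subst pos_divide_le_eq) (simp_all add: mult.commute)
      finally show "(\<Sum>i\<in>{1..N}. - w (x i) / t) \<le> c x" .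
    qed (use w_int in auto)
    from D[OF this] have "- (N * (\<integral>x. w x \<partial>\<rho>)) / t \<le> D" by simp
    then have "- (N * (\<integral>x. w x \<partial>\<rho>)) \<le> D * t" using t by (simp only: pos_divide_le_eq)
    then show ?thesis using u(4) w_sum by (simp add: algebra_simps)
  qed
qed

text \<open>The infimum of the covers is finite by \<open>covers_zero\<close>: a cover of
  \<open>f\<close> and one of \<open>- f\<close> add up to a cover of 0.\<close>

lemma dual_functional:
  assumes D: "\<And>v. admissible v \<Longrightarrow> N * (\<integral>x. v x \<partial>\<rho>) \<le> D"
  obtains L where
    "\<And>f g. bounded (range f) \<Longrightarrow> bounded (range g) \<Longrightarrow> L (\<lambda>x. f x + g x) = L f + L g"
    "\<And>a f. bounded (range f) \<Longrightarrow> L (\<lambda>x. a * f x) = a * L f"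
    "\<And>f s. bounded (range f) \<Longrightarrow> s \<in> covers D f \<Longrightarrow> L f \<le> s"
proof -
  have ne: "covers D f \<noteq> {}" if "bounded (range f)" for f
  proof -
    obtain K where K: "\<And>x. \<bar>f x\<bar> \<le> K"
      using \<open>bounded (range f)\<close> by (auto simp: bounded_iff)
    have "K \<in> covers D f" using K by (intro covers_const) (rule abs_le_D1)
    then show ?thesis by auto
  qed
  have bdd: "bdd_below (covers D f)" if "bounded (range f)" for f
  proof -
    have "bounded (range (\<lambda>x. - f x))" using that by (simp add: bounded_uminus image_image[symmetric])
    then obtain s' where s': "s' \<in> covers D (\<lambda>x. - f x)" using ne by blast
    have "- s' \<le> s" if "s \<in> covers D f" for s
      using covers_zero[OF D, of "s + s'"] covers_add[OF that s'] by simp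
    then show ?thesis by (rule bdd_belowI)
  qed
  define p where "p f = Inf (covers D f)" for f
  have p_le: "p f \<le> s" if "bounded (range f)" "s \<in> covers D f" for f s
    unfolding p_def using that by (intro cInf_lower bdd)
  have p_ge: "b \<le> p f" if "bounded (range f)" "\<And>s. s \<in> covers D f \<Longrightarrow> b \<le> s" for f b
    unfolding p_def using that ne by (intro cInf_greatest) auto
  obtain L where L:
    "\<And>f g. bounded (range f) \<Longrightarrow> bounded (range g) \<Longrightarrow> L (\<lambda>x. f x + g x) = L f + L g"
    "\<And>a f. bounded (range f) \<Longrightarrow> L (\<lambda>x. a * f x) = a * L f"
    "\<And>f. bounded (range f) \<Longrightarrow> L f \<le> p f"
  proof (rule hahn_banach_bounded[of p])
    fix f g :: "(nat \<Rightarrow> 'a) \<Rightarrow> real" assume fg: "bounded (range f)" "bounded (range g)"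
    have *: "p (\<lambda>x. f x + g x) \<le> s + s'" if "s \<in> covers D f" "s' \<in> covers D g" for s s'
      using covers_add[OF that] fg by (intro p_le bounded_plus_comp)
    have "p (\<lambda>x. f x + g x) - s' \<le> p f" if "s' \<in> covers D g" for s'
      using *[OF _ that] by (intro p_ge fg) (simp add: algebra_simps)
    then have "p (\<lambda>x. f x + g x) - p f \<le> p g"
      by (intro p_ge fg) (simp add: algebra_simps)
    then show "p (\<lambda>x. f x + g x) \<le> p f + p g" by simp
  next
    fix a :: real and f :: "(nat \<Rightarrow> 'a) \<Rightarrow> real" assume a: "a > 0" and f: "bounded (range f)"
    have af: "bounded (range (\<lambda>x. a * f x))"
      using bounded_scaling[OF f, of a] by (simp add: image_image)
    have "p (\<lambda>x. a * f x) / a \<le> p f"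
    proof (rule p_ge[OF f])
      fix s assume "s \<in> covers D f"
      from p_le[OF af covers_scale[OF this a]] show "p (\<lambda>x. a * f x) / a \<le> s"
        using a by (simp add: divide_le_eq mult.commute)
    qed
    then show "p (\<lambda>x. a * f x) \<le> a * p f" using a by (simp add: divide_le_eq mult.commute)
  qed blast
  have "L f \<le> s" if "bounded (range f)" "s \<in> covers D f" for f s
    using L(3)[OF that(1)] p_le[OF that] by simp
  with L(1,2) show thesis by (rule that)
qed

end

section \<open>From the functional to a plan\<close>

context symmetric_cost
begin

text \<open>Applied to indicators, \<open>L\<close> is a finitely additive set function whose
  marginals are the tight measure \<open>\<rho>\<close>. So cylinders belong to
  \<open>compact_approx\<close> and the extension is a plan; its cost is then compared with
  \<open>L c\<close> by slicing \<open>c\<close> into superlevel sets.\<close>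

lemma plan_of_functional:
  assumes L_add: "\<And>f g. bounded (range f) \<Longrightarrow> bounded (range g) \<Longrightarrow> L (\<lambda>x. f x + g x) = L f + L g"
    and L_scale: "\<And>a f. bounded (range f) \<Longrightarrow> L (\<lambda>x. a * f x) = a * L f"
    and L_le: "\<And>f s. bounded (range f) \<Longrightarrow> s \<in> covers D f \<Longrightarrow> L f \<le> s"
  obtains P where "P \<in> plans N \<rho>" "integrable P c" "(\<integral>x. c x \<partial>P) \<le> D"
proof -
  have fin: "finite {1..N}" by simp
  define Pr where "Pr = (\<Pi>\<^sub>M i\<in>{1..N}. borel :: 'a measure)"
  have sp: "space Pr = X" by (auto simp: Pr_def X_def space_PiM)
  have X_iff: "x \<in> X \<longleftrightarrow> (\<forall>i. i \<notin> {1..N} \<longrightarrow> x i = undefined)" for x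
    unfolding X_def PiE_iff extensional_def by blast
  have bI: "bounded (range (indicator A :: (nat \<Rightarrow> 'a) \<Rightarrow> real))" for A
    by (auto simp: bounded_iff indicator_def intro!: exI[of _ 1])
  have bS: "bounded (range (\<lambda>x. a * f x))" if "bounded (range f)" for a :: real and f :: "(nat \<Rightarrow> 'a) \<Rightarrow> real"
    using bounded_scaling[OF that, of a] by (simp add: image_image)
  \<comment> \<open>Covers look at a function on \<open>X\<close> only, so values elsewhere do not
    influence \<open>L\<close>.\<close>
  have L_mono: "L f \<le> L g" if "bounded (range f)" "bounded (range g)" "\<And>x. x \<in> X \<Longrightarrow> f x \<le> g x" for f g
  proof -
    have "0 \<in> covers D (\<lambda>x. f x + (- 1) * g x)"
      using that by (intro covers_const) auto
    then have "L (\<lambda>x. f x + (- 1) * g x) \<le> 0"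
      using that bS[of g "-1"] by (intro L_le bounded_plus_comp) auto
    then show ?thesis
      using that bS[of g "-1"] L_add[of f "\<lambda>x. (- 1) * g x"] L_scale[of g "-1"] by simp
  qed
  have L_cong: "L f = L g" if "bounded (range f)" "bounded (range g)" "\<And>x. x \<in> X \<Longrightarrow> f x = g x" for f g
    using that by (intro antisym L_mono) auto
  define m where "m A = L (indicator A)" for A
  have L_zero: "L (\<lambda>_. 0) = 0" using L_scale[of "\<lambda>_. 0" 0] by simp
  have L_const: "L (\<lambda>_. a) = a" for a
  proof (rule antisym)
    show "L (\<lambda>_. a) \<le> a" by (intro L_le covers_const) auto
    have "L (\<lambda>_. - a) \<le> - a" by (intro L_le covers_const) auto
    then show "a \<le> L (\<lambda>_. a)" using L_scale[of "\<lambda>_. a" "-1"] by simp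
  qed
  have marg: "m {x\<in>X. x i \<in> B} = measure \<rho> B" if i: "i \<in> {1..N}" and B: "B \<in> sets borel" for i B
  proof (rule antisym)
    have Bs: "B \<in> sets \<rho>" using B sets_rho by simp
    \<comment> \<open>The factor may have either sign: 1 and -1 give the two inequalities for the
      marginal.\<close>
    have bounds: "a * m {x\<in>X. x i \<in> B} \<le> a * measure \<rho> B" for a
    proof -
      have "a * measure \<rho> B \<in> covers D (\<lambda>x. a * indicator {x\<in>X. x i \<in> B} x)"
      proof (rule coversI[where t = 0 and u = "\<lambda>j y. if j = i then a * indicator B y else 0"])
        fix x assume "x \<in> X"
        then show "a * indicator {x\<in>X. x i \<in> B} x \<le> (\<Sum>j\<in>{1..N}. if j = i then a * indicator B (x j) else 0) + 0 * c x"
          using i by (simp add: indicator_def)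
      next
        show "a * measure \<rho> B = (\<Sum>j\<in>{1..N}. \<integral>y. (if j = i then a * indicator B y else 0) \<partial>\<rho>) + 0 * D"
        proof -
          have "(\<integral>y. (if j = i then a * indicator B y else 0) \<partial>\<rho>) = (if j = i then a * measure \<rho> B else 0)" for j
            using Bs by auto
          then show ?thesis using i by simp
        qed
      next
        show "integrable \<rho> (\<lambda>y. if j = i then a * indicator B y else 0)" for j
          using Bs by (cases "j = i") (auto simp: emeasure_eq_measure)
      qed simp
      from L_le[OF bS[OF bI] this] show ?thesis by (simp add: m_def L_scale[OF bI])
    qed
    show "m {x\<in>X. x i \<in> B} \<le> measure \<rho> B" using bounds[of 1] by simp
    show "measure \<rho> B \<le> m {x\<in>X. x i \<in> B}" using bounds[of "-1"] by simp
  qed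
  have m_nonneg: "0 \<le> m A" for A
    using L_mono[of "\<lambda>_. 0" "indicator A"] bI by (simp add: m_def L_zero)
  have m_Un: "m (A \<union> B) = m A + m B" if "A \<inter> B = {}" for A B
  proof -
    have "(indicator (A \<union> B) :: _ \<Rightarrow> real) = (\<lambda>x. indicator A x + indicator B x)"
      using that by (auto simp: indicator_def fun_eq_iff)
    then show ?thesis by (simp add: m_def L_add bI)
  qed
  have m_mono: "m A \<le> m B" if "A \<subseteq> B" for A B
    using that unfolding m_def by (intro L_mono bI) (auto simp: indicator_def)
  have m_sub: "m (A \<union> B) \<le> m A + m B" for A B
    using m_Un[of A "B - A"] m_mono[of "B - A" B] by auto
  have m_empty: "m {} = 0" using m_Un[of "{}" "{}"] by simp
  have m_UN: "m (\<Union>i\<in>I. A i) \<le> (\<Sum>i\<in>I. m (A i))" if "finite I" for I :: "nat set" and A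
    using that
  proof (induction I)
    case (insert i I)
    then show ?case using m_sub[of "A i" "\<Union>i\<in>I. A i"] by simp
  qed (simp add: m_empty)
  \<comment> \<open>Inner regularity of \<open>\<rho>\<close> in each coordinate, with error
    \<open>e / N\<close>; what a compact box misses is covered by N cylinders, whose masses are
    known from the marginals.\<close>
  have box: "\<exists>K. compact K \<and> K \<subseteq> Pi\<^sub>E {1..N} B \<and> m (Pi\<^sub>E {1..N} B - K) < e"
    if B: "\<And>i. i \<in> {1..N} \<Longrightarrow> B i \<in> sets borel" and e: "e > 0" for B e
  proof -
    have "\<exists>H. compact H \<and> H \<subseteq> B i \<and> measure \<rho> (B i - H) < e / N" if "i \<in> {1..N}" for i
    proof -
      have "e / N > 0" using e N by simp
      from inner_approx[OF finite_measure_axioms sets_rho B[OF that] this] show ?thesis by metis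
    qed
    then obtain H where H: "\<And>i. i \<in> {1..N} \<Longrightarrow> compact (H i)" "\<And>i. i \<in> {1..N} \<Longrightarrow> H i \<subseteq> B i"
      "\<And>i. i \<in> {1..N} \<Longrightarrow> measure \<rho> (B i - H i) < e / N" by metis
    have "compact (Pi\<^sub>E {1..N} H)"
    proof -
      have eq: "Pi\<^sub>E {1..N} H = Pi\<^sub>E UNIV (\<lambda>i. if i \<in> {1..N} then H i else {undefined})"
        by (auto simp: PiE_iff extensional_def split: if_splits)
      have "compactin (product_topology (\<lambda>i. euclidean) UNIV) (Pi\<^sub>E UNIV (\<lambda>i. if i \<in> {1..N} then H i else {undefined}))"
        unfolding compactin_PiE using H(1) by auto
      then show ?thesis unfolding eq euclidean_product_topology by simp
    qed
    moreover have "Pi\<^sub>E {1..N} H \<subseteq> Pi\<^sub>E {1..N} B" using H(2) by (intro PiE_mono) auto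
    moreover have "m (Pi\<^sub>E {1..N} B - Pi\<^sub>E {1..N} H) < e"
    proof -
      have "Pi\<^sub>E {1..N} B - Pi\<^sub>E {1..N} H \<subseteq> (\<Union>i\<in>{1..N}. {x\<in>X. x i \<in> B i - H i})"
        by (auto simp: PiE_iff X_def)
      then have "m (Pi\<^sub>E {1..N} B - Pi\<^sub>E {1..N} H) \<le> (\<Sum>i\<in>{1..N}. m {x\<in>X. x i \<in> B i - H i})"
        using m_mono m_UN[OF fin] by (meson order.trans)
      also have "\<dots> = (\<Sum>i\<in>{1..N}. measure \<rho> (B i - H i))"
        using B H(1) by (intro sum.cong refl marg) (auto simp: compact_imp_closed)
      also have "\<dots> < (\<Sum>i\<in>{1..N}. e / N)"
        using H(3) N by (intro sum_strict_mono) auto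
      finally show ?thesis using N by simp
    qed
    ultimately show ?thesis by blast
  qed
  interpret F: finitely_additive X m
  proof
    fix e :: real assume "e > 0"
    then show "\<exists>K. compact K \<and> K \<subseteq> X \<and> m (X - K) < e"
      using box[of "\<lambda>_. UNIV" e] by (simp add: X_def)
  qed (auto intro: m_nonneg m_Un)
  interpret A: algebra X F.compact_approx by (rule F.algebra_compact_approx)
  \<comment> \<open>The cylinder over \<open>B\<close> and its complement in \<open>X\<close>, the
    cylinder over \<open>- B\<close>, are both boxes, so \<open>box\<close> supplies the inner and
    the outer compact set.\<close>
  have cyl: "{x\<in>X. x i \<in> B} \<in> F.compact_approx" if i: "i \<in> {1..N}" and B: "B \<in> sets borel" for i B
    unfolding F.compact_approx_def
  proof (intro CollectI conjI allI impI)
    fix e :: real assume "e > 0"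
    then have e: "e / 2 > 0" by simp
    have eq: "Pi\<^sub>E {1..N} (\<lambda>j. if j = i then B else UNIV) = {x\<in>X. x i \<in> B}" for B :: "'a set"
    proof (rule set_eqI)
      fix x :: "nat \<Rightarrow> 'a"
      have "(\<forall>j\<in>{1..N}. x j \<in> (if j = i then B else UNIV)) \<longleftrightarrow> x i \<in> B"
        using i by (auto dest: bspec[where x = i])
      then show "x \<in> Pi\<^sub>E {1..N} (\<lambda>j. if j = i then B else UNIV) \<longleftrightarrow> x \<in> {x\<in>X. x i \<in> B}"
        unfolding X_def PiE_iff by auto
    qed
    have mb: "(if j = i then B else UNIV) \<in> sets borel" if "B \<in> sets borel" for j and B :: "'a set"
      using that by simp
    have Bc: "- B \<in> sets borel" using B by simp
    obtain K where K: "compact K" "K \<subseteq> {x\<in>X. x i \<in> B}" "m ({x\<in>X. x i \<in> B} - K) < e / 2"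
      using box[of "\<lambda>j. if j = i then B else UNIV", OF mb[OF B] e] unfolding eq by blast
    obtain K' where K': "compact K'" "K' \<subseteq> {x\<in>X. x i \<in> - B}" "m ({x\<in>X. x i \<in> - B} - K') < e / 2"
      using box[of "\<lambda>j. if j = i then - B else UNIV", OF mb[OF Bc] e] unfolding eq by blast
    have "m (X - (K \<union> K')) \<le> m (({x\<in>X. x i \<in> B} - K) \<union> ({x\<in>X. x i \<in> - B} - K'))"
      by (intro m_mono) auto
    also have "\<dots> \<le> m ({x\<in>X. x i \<in> B} - K) + m ({x\<in>X. x i \<in> - B} - K')" by (rule m_sub)
    also have "\<dots> < e" using K(3) K'(3) by simp
    finally show "\<exists>K K'. compact K \<and> compact K' \<and> K \<subseteq> {x\<in>X. x i \<in> B} \<and> K' \<subseteq> X - {x\<in>X. x i \<in> B} \<and> m (X - (K \<union> K')) < e"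
      using K K' by (intro exI[of _ K] exI[of _ K']) auto
  qed auto
  obtain Q where Q: "space Q = X" "F.compact_approx \<subseteq> sets Q"
    "\<And>E. E \<in> F.compact_approx \<Longrightarrow> emeasure Q E = ennreal (m E)"
    using F.extension by blast
  have id_meas: "(\<lambda>x. x) \<in> measurable Q Pr"
    unfolding Pr_def
  proof (rule measurable_PiM_single)
    show "(\<lambda>x. x) \<in> space Q \<rightarrow> (\<Pi>\<^sub>E i\<in>{1..N}. space borel)" by (auto simp: Q X_def)
    show "{x \<in> space Q. x i \<in> B} \<in> sets Q" if "B \<in> sets borel" "i \<in> {1..N}" for B i
      using cyl[OF that(2,1)] Q by auto
  qed
  \<comment> \<open>\<open>sets Q\<close> is only known to contain the algebra, whereas a plan must
    live on the product sigma-algebra. The push-forward along the identity restricts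
    \<open>Q\<close> to it.\<close>
  define P where "P = distr Q Pr (\<lambda>x. x)"
  have sets_P: "sets P = sets Pr" and space_P: "space P = X" by (simp_all add: P_def sp)
  have P_eq: "emeasure P E = emeasure Q E" if "E \<in> sets Pr" for E
    using that sets.sets_into_space[OF that] unfolding P_def
    by (subst emeasure_distr[OF id_meas]) (auto simp: Q sp intro!: arg_cong[where f = "emeasure Q"])
  have X_in: "X \<in> F.compact_approx" by (rule A.top)
  have mX: "m X = 1"
    using L_cong[of "indicator X" "\<lambda>_. 1"] bI L_const[of 1] by (simp add: m_def)
  have "emeasure P (space P) = 1"
    using P_eq[of X] Q(3)[OF X_in] sets.top[of Pr] by (simp add: space_P mX sp)
  then interpret P: prob_space P by (rule prob_spaceI)
  have P_meas [measurable]: "(\<lambda>x. x i) \<in> measurable P borel" if "i \<in> {1..N}" for i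
    using that by (simp add: measurable_cong_sets[OF sets_P refl] Pr_def)
  have plan: "P \<in> plans N \<rho>"
    unfolding plans_def
  proof (intro CollectI conjI ballI)
    show "prob_space P" by (rule P.prob_space_axioms)
    show "sets P = sets (\<Pi>\<^sub>M i\<in>{1..N}. borel)" by (simp add: sets_P Pr_def)
    fix i assume i: "i \<in> {1..N}"
    show "distr P borel (\<lambda>x. x i) = \<rho>"
    proof (rule measure_eqI)
      fix B assume "B \<in> sets (distr P borel (\<lambda>x. x i))"
      then have B: "B \<in> sets borel" by simp
      have cs: "{x\<in>X. x i \<in> B} \<in> sets Pr"
      proof -
        have "(\<lambda>x. x i) -` B \<inter> space P \<in> sets P" using P_meas[OF i] B by (rule measurable_sets)
        then show ?thesis by (simp add: sets_P space_P vimage_def Int_def conj_commute)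
      qed
      have "emeasure (distr P borel (\<lambda>x. x i)) B = emeasure P {x\<in>X. x i \<in> B}"
        using B P_meas[OF i] by (subst emeasure_distr) (auto simp: space_P intro!: arg_cong[where f = "emeasure P"])
      also have "\<dots> = ennreal (measure \<rho> B)" using P_eq[OF cs] Q(3)[OF cyl[OF i B]] marg[OF i B] by simp
      finally show "emeasure (distr P borel (\<lambda>x. x i)) B = emeasure \<rho> B" by (simp add: emeasure_eq_measure)
    qed (simp add: sets_rho)
  qed
  \<comment> \<open>On \<open>X\<close>, an open set is a countable union of basic boxes. Finite
    unions of them lie in the algebra, where \<open>P\<close> and \<open>m\<close> agree; continuity
    from below of \<open>P\<close> and monotonicity of \<open>m\<close> leave this inequality for
    the union.\<close>
  have open_le: "U \<inter> X \<in> sets P \<and> measure P (U \<inter> X) \<le> m (U \<inter> X)" if U: "open U" for U :: "(nat \<Rightarrow> 'a) set"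
  proof -
    obtain T :: "(nat \<Rightarrow> 'a) set set" where T: "topological_basis T \<and> countable T \<and>
      (\<forall>k\<in>T. \<exists>Y. k = Pi\<^sub>E UNIV Y \<and> (\<forall>i. open (Y i)) \<and> finite {i. Y i \<noteq> UNIV})"
      by (rule exE[OF product_topology_countable_basis])
    note T_basis = conjunct1[OF T] and T_rest = conjunct2[OF T]
    note T_countable = conjunct1[OF T_rest] and T_boxes = conjunct2[OF T_rest]
    have T_in: "k \<inter> X \<in> F.compact_approx \<and> k \<inter> X \<in> sets Pr" if "k \<in> T" for k
    proof -
      obtain Y where Y: "k = Pi\<^sub>E UNIV Y \<and> (\<forall>i. open (Y i)) \<and> finite {i. Y i \<noteq> UNIV}"
        by (rule exE[OF bspec[OF T_boxes \<open>k \<in> T\<close>]])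
      then have Y_open: "open (Y i)" for i by simp
      have k_iff: "x \<in> k \<longleftrightarrow> (\<forall>i. x i \<in> Y i)" for x
        unfolding conjunct1[OF Y] by (simp add: PiE_iff)
      \<comment> \<open>A basic box may also restrict coordinates outside \<open>{1..N}\<close>. As
        points of \<open>X\<close> are \<open>undefined\<close> there, these restrictions either
        always hold on \<open>X\<close> or leave nothing of the box.\<close>
      show ?thesis
      proof (cases "\<forall>i. i \<notin> {1..N} \<longrightarrow> undefined \<in> Y i")
        case True
        have kX: "x \<in> k \<inter> X \<longleftrightarrow> x \<in> X \<and> (\<forall>i\<in>{1..N}. x i \<in> Y i)" for x
          using True unfolding Int_iff k_iff X_iff by metis
        have "k \<inter> X = (\<Inter>i\<in>{1..N}. {x\<in>X. x i \<in> Y i})"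
        proof (rule set_eqI)
          have "1 \<in> {1..N}" using N by simp
          then show "x \<in> k \<inter> X \<longleftrightarrow> x \<in> (\<Inter>i\<in>{1..N}. {x\<in>X. x i \<in> Y i})" for x
            unfolding kX INT_iff mem_Collect_eq by metis
        qed
        moreover have "(\<Inter>i\<in>{1..N}. {x\<in>X. x i \<in> Y i}) \<in> F.compact_approx"
        proof (rule A.finite_INT)
          show "{1..N} \<noteq> {}" using N by simp
          show "{x\<in>X. x i \<in> Y i} \<in> F.compact_approx" if "i \<in> {1..N}" for i
            using that borel_open[OF Y_open] by (rule cyl)
        qed simp
        moreover have "k \<inter> X = Pi\<^sub>E {1..N} Y"
        proof (rule set_eqI)
          show "x \<in> k \<inter> X \<longleftrightarrow> x \<in> Pi\<^sub>E {1..N} Y" for x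
            unfolding kX unfolding X_def PiE_iff by blast
        qed
        moreover have "Pi\<^sub>E {1..N} Y \<in> sets Pr"
          unfolding Pr_def using Y_open by (intro sets_PiM_I_finite) auto
        ultimately show ?thesis by metis
      next
        case False
        then obtain i where "i \<notin> {1..N}" "undefined \<notin> Y i" by blast
        then have "x \<notin> k \<inter> X" for x unfolding Int_iff k_iff X_iff by metis
        then have "k \<inter> X = {}" by blast
        then show ?thesis by simp
      qed
    qed
    obtain T' where T': "T' \<subseteq> T" "U = \<Union>T'" using T_basis U unfolding topological_basis_def by metis
    show ?thesis
    proof (cases "T' = {}")
      case True
      then show ?thesis using T'(2) m_nonneg by simp
    next
      case False
      have "countable T'" using T_countable T'(1) countable_subset by metis
      define k where "k = from_nat_into T'"
      have k: "k n \<in> T" "range k = T'" for n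
        using T'(1) from_nat_into[OF False] range_from_nat_into[OF False \<open>countable T'\<close>] by (auto simp: k_def)
      define E where "E n = (\<Union>j\<in>{..n}. k j \<inter> X)" for n
      have E: "E n \<in> F.compact_approx" "E n \<in> sets Pr" for n
        unfolding E_def
        by (rule A.finite_UN, simp, rule conjunct1[OF T_in[OF k(1)]])
          (rule sets.finite_UN, simp, rule conjunct2[OF T_in[OF k(1)]])
      have UE: "(\<Union>n. E n) = U \<inter> X"
        unfolding E_def T'(2) k(2)[symmetric] by auto
      have sU: "U \<inter> X \<in> sets P" unfolding UE[symmetric] sets_P using E(2) by auto
      have "incseq E" unfolding E_def incseq_def by fastforce
      then have "(\<lambda>n. measure P (E n)) \<longlonglongrightarrow> measure P (U \<inter> X)"
        unfolding UE[symmetric] using E(2) by (intro P.finite_Lim_measure_incseq) (auto simp: sets_P)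
      moreover have "measure P (E n) \<le> m (U \<inter> X)" for n
      proof -
        have "ennreal (measure P (E n)) = ennreal (m (E n))"
          using P_eq[OF E(2)] Q(3)[OF E(1)] by (simp add: P.emeasure_eq_measure)
        then have "measure P (E n) = m (E n)" using m_nonneg by simp
        also have "\<dots> \<le> m (U \<inter> X)" using UE by (intro m_mono) auto
        finally show ?thesis .
      qed
      ultimately show ?thesis using sU by (intro conjI) (auto intro: LIMSEQ_le_const2)
    qed
  qed
  have gt: "{x \<in> X. a < c x} \<in> sets P" "measure P {x \<in> X. a < c x} \<le> m {x \<in> X. a < c x}" for a
  proof -
    have "{x \<in> X. a < c x} = {x. a < c x} \<inter> X" by auto
    moreover have "open {x. a < c x}" using c_continuous by (intro open_Collect_less) auto
    ultimately show "{x \<in> X. a < c x} \<in> sets P" "measure P {x \<in> X. a < c x} \<le> m {x \<in> X. a < c x}"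
      using open_le[of "{x. a < c x}"] by auto
  qed
  have c_meas [measurable]: "c \<in> borel_measurable P"
    using gt(1) by (intro borel_measurableI_greater) (simp add: space_P)
  have c_bdd: "bounded (range c)" using c_nonneg c_le by (auto simp: bounded_iff intro!: exI[of _ M])
  have c_int: "integrable P c"
    using c_nonneg c_le by (intro P.integrable_const_bound[where B = M]) auto
  \<comment> \<open>All \<open>u i\<close> are 0 and \<open>t = 1\<close>: the cost covers itself at
    the price \<open>D\<close>.\<close>
  have Lc: "L c \<le> D"
    using c_bdd by (intro L_le coversI[where t = 1 and u = "\<lambda>_ _. 0"]) auto
  have M0: "M \<ge> 0" using c_nonneg c_le order.trans by blast
  have L_sum: "L (\<lambda>x. \<Sum>k\<in>J. f k x) = (\<Sum>k\<in>J. L (f k)) \<and> bounded (range (\<lambda>x. \<Sum>k\<in>J. f k x))"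
    if "finite J" and f: "\<And>k. bounded (range (f k))" for J :: "nat set" and f
    using that(1)
  proof (induction J)
    case (insert k J)
    then show ?case
      using L_add[OF f[of k], of "\<lambda>x. \<Sum>k\<in>J. f k x"] bounded_plus_comp[OF f[of k], of "\<lambda>x. \<Sum>k\<in>J. f k x"]
      by simp
  qed (simp add: L_zero)
  have "(\<integral>x. c x \<partial>P) \<le> D + M * (1 / real (Suc n))" for n
  proof -
    \<comment> \<open>With this step \<open>Suc n * h\<close> equals \<open>M\<close>, so the
      truncation in \<open>layer_bounds\<close> is void for \<open>c\<close>, and the error
      \<open>h\<close> tends to 0.\<close>
    define h where "h = M / Suc n"
    have h: "h \<ge> 0" "Suc n * h = M" using M0 by (simp_all add: h_def)
    let ?A = "\<lambda>k::nat. {x \<in> X. k * h < c x}"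
    note Lsum = L_sum[of "{1..n}" "\<lambda>k x. h * indicator (?A k) x", OF _ bS[OF bI]]
    have A_int: "integrable P (\<lambda>x. h * indicator (?A k) x :: real)" for k
      using gt(1)[of "k * h"] by (intro integrable_mult_right) (simp add: P.emeasure_eq_measure)
    have ind: "indicator (?A k) x = (of_bool (real k * h < c x) :: real)" if "x \<in> X" for k x
      using that by simp
    have "(\<integral>x. c x \<partial>P) \<le> (\<integral>x. h + (\<Sum>k\<in>{1..n}. h * indicator (?A k) x) \<partial>P)"
    proof (rule integral_mono[OF c_int])
      show "integrable P (\<lambda>x. h + (\<Sum>k\<in>{1..n}. h * indicator (?A k) x))"
        by (intro Bochner_Integration.integrable_add Bochner_Integration.integrable_sum P.integrable_const A_int)
      fix x assume "x \<in> space P"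
      then have "x \<in> X" by (simp add: space_P)
      have "c x = min (c x) (Suc n * h)" using h(2) c_le[of x] by simp
      also have "\<dots> \<le> h + (\<Sum>k\<in>{1..n}. h * of_bool (real k * h < c x))"
        by (rule layer_bounds(2)[OF c_nonneg h(1)])
      finally show "c x \<le> h + (\<Sum>k\<in>{1..n}. h * indicator (?A k) x)" by (simp only: ind[OF \<open>x \<in> X\<close>])
    qed
    also have "\<dots> = h + (\<Sum>k\<in>{1..n}. h * measure P (?A k))"
    proof -
      have "(\<integral>x. h + (\<Sum>k\<in>{1..n}. h * indicator (?A k) x) \<partial>P) =
        (\<integral>x. h \<partial>P) + (\<integral>x. (\<Sum>k\<in>{1..n}. h * indicator (?A k) x) \<partial>P)"
        by (rule Bochner_Integration.integral_add) (intro P.integrable_const Bochner_Integration.integrable_sum A_int)+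
      also have "(\<integral>x. (\<Sum>k\<in>{1..n}. h * indicator (?A k) x) \<partial>P) = (\<Sum>k\<in>{1..n}. \<integral>x. h * indicator (?A k) x \<partial>P)"
        by (rule Bochner_Integration.integral_sum) (rule A_int)
      also have "\<dots> = (\<Sum>k\<in>{1..n}. h * measure P (?A k))"
      proof (rule sum.cong[OF refl])
        show "(\<integral>x. h * indicator (?A k) x \<partial>P) = h * measure P (?A k)" for k
          using gt(1)[of "k * h"] by (simp add: P.emeasure_eq_measure)
      qed
      finally show ?thesis by (simp only: lebesgue_integral_const P.prob_space) simp
    qed
    also have "\<dots> \<le> h + (\<Sum>k\<in>{1..n}. h * m (?A k))"
      using gt(2) h(1) by (intro add_left_mono sum_mono mult_left_mono)
    also have "(\<Sum>k\<in>{1..n}. h * m (?A k)) = (\<Sum>k\<in>{1..n}. L (\<lambda>x. h * indicator (?A k) x))"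
      by (simp only: m_def L_scale[OF bI])
    also have "\<dots> = L (\<lambda>x. \<Sum>k\<in>{1..n}. h * indicator (?A k) x)"
      by (rule conjunct1[OF Lsum, symmetric]) simp
    also have "\<dots> \<le> L c"
    proof (rule L_mono[OF _ c_bdd])
      fix x assume "x \<in> X"
      have "(\<Sum>k\<in>{1..n}. h * of_bool (real k * h < c x)) \<le> min (c x) (n * h)"
        by (rule layer_bounds(1)[OF c_nonneg h(1)])
      also have "\<dots> \<le> c x" by simp
      finally show "(\<Sum>k\<in>{1..n}. h * indicator (?A k) x) \<le> c x" by (simp only: ind[OF \<open>x \<in> X\<close>])
    qed (rule conjunct2[OF Lsum], simp)
    finally show ?thesis using Lc by (simp add: h_def)
  qed
  moreover have "(\<lambda>n. D + M * (1 / real (Suc n))) \<longlonglongrightarrow> D + M * 0"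
    by (intro tendsto_intros LIMSEQ_Suc[OF lim_1_over_n])
  ultimately have "(\<integral>x. c x \<partial>P) \<le> D" by (intro LIMSEQ_le_const[where X = "\<lambda>n. D + M * (1 / real (Suc n))"]) auto
  then show thesis using plan c_int by (intro that)
qed

lemma duality:
  obtains u P where "admissible u" "P \<in> plans N \<rho>" "integrable P c" "(\<integral>x. c x \<partial>P) \<le> N * (\<integral>x. u x \<partial>\<rho>)"
proof -
  obtain u where u: "admissible u" "\<And>v. admissible v \<Longrightarrow> (\<integral>x. v x \<partial>\<rho>) \<le> (\<integral>x. u x \<partial>\<rho>)"
    using dual_attained by blast
  have D: "N * (\<integral>x. v x \<partial>\<rho>) \<le> N * (\<integral>x. u x \<partial>\<rho>)" if "admissible v" for v
    using u(2)[OF that] by (simp add: mult_left_mono)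
  obtain L where L:
    "\<And>f g. bounded (range f) \<Longrightarrow> bounded (range g) \<Longrightarrow> L (\<lambda>x. f x + g x) = L f + L g"
    "\<And>a f. bounded (range f) \<Longrightarrow> L (\<lambda>x. a * f x) = a * L f"
    "\<And>f s. bounded (range f) \<Longrightarrow> s \<in> covers (N * (\<integral>x. u x \<partial>\<rho>)) f \<Longrightarrow> L f \<le> s"
    using dual_functional[OF D] by blast
  obtain P where "P \<in> plans N \<rho>" "integrable P c" "(\<integral>x. c x \<partial>P) \<le> N * (\<integral>x. u x \<partial>\<rho>)"
    using plan_of_functional[where L = L and D = "N * (\<integral>x. u x \<partial>\<rho>)", OF L] by blast
  with u(1) show thesis by (rule that)
qed

end

subsection \<open>Truncated repulsive costs\<close>

text \<open>The full square, unlike the triangle, is stable under reindexing by a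
  permutation.\<close>

lemma sum_upper_triangle:
  fixes h :: "nat \<Rightarrow> nat \<Rightarrow> real"
  assumes "\<And>i j. h i j = h j i"
  shows "(\<Sum>i\<in>{1..N}. \<Sum>j\<in>{i<..N}. h i j) = ((\<Sum>i\<in>{1..N}. \<Sum>j\<in>{1..N}. h i j) - (\<Sum>i\<in>{1..N}. h i i)) / 2"
proof -
  have "(\<Sum>i\<in>{1..N}. \<Sum>j\<in>{j\<in>{1..N}. j < i}. h i j) = (\<Sum>j\<in>{1..N}. \<Sum>i\<in>{i\<in>{1..N}. j < i}. h i j)"
    by (rule sum.swap_restrict) auto
  also have "\<dots> = (\<Sum>j\<in>{1..N}. \<Sum>i\<in>{j<..N}. h j i)"
    using assms by (intro sum.cong refl) auto
  finally have low: "(\<Sum>i\<in>{1..N}. \<Sum>j\<in>{j\<in>{1..N}. j < i}. h i j) = (\<Sum>i\<in>{1..N}. \<Sum>j\<in>{i<..N}. h i j)" .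
  have "(\<Sum>j\<in>{1..N}. h i j) = (\<Sum>j\<in>{j\<in>{1..N}. j < i}. h i j) + h i i + (\<Sum>j\<in>{i<..N}. h i j)"
    if "i \<in> {1..N}" for i
  proof -
    have "{1..N} = {j\<in>{1..N}. j < i} \<union> insert i {i<..N}" using that by auto
    then have "(\<Sum>j\<in>{1..N}. h i j) = (\<Sum>j\<in>{j\<in>{1..N}. j < i} \<union> insert i {i<..N}. h i j)"
      by (rule arg_cong)
    also have "\<dots> = (\<Sum>j\<in>{j\<in>{1..N}. j < i}. h i j) + (\<Sum>j\<in>insert i {i<..N}. h i j)"
      by (rule sum.union_disjoint) auto
    finally show ?thesis by simp
  qed
  then have "(\<Sum>i\<in>{1..N}. \<Sum>j\<in>{1..N}. h i j) =
    (\<Sum>i\<in>{1..N}. (\<Sum>j\<in>{j\<in>{1..N}. j < i}. h i j) + h i i + (\<Sum>j\<in>{i<..N}. h i j))"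
    by (rule sum.cong[OF refl])
  then show ?thesis using low by (simp only: sum.distrib) simp
qed

section \<open>Weak duality\<close>

lemma plans_marginal:
  fixes v :: "'a::euclidean_space \<Rightarrow> real"
  assumes "P \<in> plans N \<rho>" "sets \<rho> = sets borel" "integrable \<rho> v" "i \<in> {1..N}"
  shows "integrable P (\<lambda>x. v (x i))" "(\<integral>x. v (x i) \<partial>P) = (\<integral>y. v y \<partial>\<rho>)"
proof -
  have sP: "sets P = sets (\<Pi>\<^sub>M i\<in>{1..N}. borel)" and \<rho>: "distr P borel (\<lambda>x. x i) = \<rho>"
    using assms by (auto simp: plans_def)
  have m: "(\<lambda>x. x i) \<in> measurable P borel"
    using assms(4) by (simp add: measurable_cong_sets[OF sP refl])
  have v: "v \<in> borel_measurable borel"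
    using borel_measurable_integrable[OF assms(3)] by (simp add: measurable_cong_sets[OF assms(2) refl])
  show "integrable P (\<lambda>x. v (x i))"
    using assms(3) unfolding \<rho>[symmetric] integrable_distr_eq[OF m v] .
  show "(\<integral>x. v (x i) \<partial>P) = (\<integral>y. v y \<partial>\<rho>)"
    unfolding \<rho>[symmetric] by (rule integral_distr[OF m v, symmetric])
qed

lemma plans_marginal_sum:
  fixes v :: "'a::euclidean_space \<Rightarrow> real"
  assumes "P \<in> plans N \<rho>" "sets \<rho> = sets borel" "integrable \<rho> v"
  shows "integrable P (\<lambda>x. \<Sum>i\<in>{1..N}. v (x i))" "(\<integral>x. (\<Sum>i\<in>{1..N}. v (x i)) \<partial>P) = N * (\<integral>y. v y \<partial>\<rho>)"
proof -
  note * = plans_marginal[OF assms]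
  show "integrable P (\<lambda>x. \<Sum>i\<in>{1..N}. v (x i))"
    by (intro Bochner_Integration.integrable_sum *)
  have "(\<integral>x. (\<Sum>i\<in>{1..N}. v (x i)) \<partial>P) = (\<Sum>i\<in>{1..N}. \<integral>x. v (x i) \<partial>P)"
    by (intro Bochner_Integration.integral_sum *)
  then show "(\<integral>x. (\<Sum>i\<in>{1..N}. v (x i)) \<partial>P) = N * (\<integral>y. v y \<partial>\<rho>)"
    using *(2) by simp
qed

text \<open>The integral of the sum over any plan is fixed by the marginals. As the sum is signed
  and the cost may be infinite, the integral is first bounded by that of the positive part, which is
  compared with the cost in \<open>ennreal\<close>.\<close>

lemma weak_duality:
  fixes v :: "'a::euclidean_space \<Rightarrow> real"
  assumes P: "P \<in> plans N \<rho>" and \<rho>: "sets \<rho> = sets borel" and v: "v \<in> dual_admissible N \<rho> c"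
  shows "ereal (N * (\<integral>x. v x \<partial>\<rho>)) \<le> enn2ereal (\<integral>\<^sup>+x. c x \<partial>P)"
proof -
  let ?f = "\<lambda>x. \<Sum>i\<in>{1..N}. v (x i)"
  have v_int: "integrable \<rho> v" and v_le: "ereal (?f x) \<le> enn2ereal (c x)" for x
    using v by (auto simp: dual_admissible_def)
  note f = plans_marginal_sum[OF P \<rho> v_int]
  have fin: "(\<integral>\<^sup>+x. ennreal (?f x) \<partial>P) < \<infinity>"
    using f(1) by (simp add: real_integrable_def less_top)
  have "integral\<^sup>L P ?f \<le> enn2real (\<integral>\<^sup>+x. ennreal (?f x) \<partial>P)"
    unfolding real_lebesgue_integral_def[OF f(1)] by simp
  then have "ereal (integral\<^sup>L P ?f) \<le> enn2ereal (\<integral>\<^sup>+x. ennreal (?f x) \<partial>P)"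
    using fin by (metis enn2ereal_ennreal enn2real_nonneg ennreal_enn2real ereal_less_eq(3) infinity_ennreal_def)
  also have "\<dots> \<le> enn2ereal (\<integral>\<^sup>+x. c x \<partial>P)"
  proof -
    have "ennreal (?f x) \<le> c x" for x
      using v_le[of x] by (metis e2ennreal_enn2ereal e2ennreal_mono ennreal.abs_eq ereal_less_eq(3) e2ennreal_ereal)
    then show ?thesis by (intro less_eq_ennreal.rep_eq[THEN iffD1] nn_integral_mono)
  qed
  finally show ?thesis unfolding f(2) .
qed

section \<open>The truncated cost as a symmetric cost\<close>

locale truncated_repulsion = prob_space \<rho>
  for \<rho> :: "'a::euclidean_space measure" +
  fixes N :: nat and \<phi> :: "real \<Rightarrow> real" and \<alpha> :: real
  assumes N: "N > 1"
    and phi_continuous: "continuous_on {0<..} \<phi>"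
    and phi_antimono: "strict_antimono_on {0<..} \<phi>"
    and phi_nonneg: "t > 0 \<Longrightarrow> \<phi> t \<ge> 0"
    and sets_rho: "sets \<rho> = sets borel"
    and alpha: "\<alpha> > 0"
begin

lemma phi_less: "0 < s \<Longrightarrow> s < t \<Longrightarrow> \<phi> t < \<phi> s"
  using phi_antimono by (auto simp: monotone_on_def)

lemma phi_le: "0 < s \<Longrightarrow> s \<le> t \<Longrightarrow> \<phi> t \<le> \<phi> s"
  using phi_less[of s t] by (cases "s = t") auto

lemma phi_pos: "t > 0 \<Longrightarrow> \<phi> t > 0"
  using phi_less[of t "t + 1"] phi_nonneg[of "t + 1"] by simp

text \<open>Truncating the argument instead of the value keeps \<phi> away from 0, so the convention
  there disappears and everything is real.\<close>

definition kernel :: "'a \<Rightarrow> 'a \<Rightarrow> real" where "kernel p q = \<phi> (max (norm (p - q)) \<alpha>)"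

definition real_trunc_cost :: "(nat \<Rightarrow> 'a) \<Rightarrow> real" where
  "real_trunc_cost x = (\<Sum>i\<in>{1..N}. \<Sum>j\<in>{i<..N}. kernel (x i) (x j))"

lemma kernel_commute: "kernel p q = kernel q p"
  by (simp add: kernel_def norm_minus_commute)

lemma kernel_pos: "0 < kernel p q" and kernel_le: "kernel p q \<le> \<phi> \<alpha>"
  using alpha by (auto simp: kernel_def intro: phi_pos phi_le)

lemma real_trunc_cost_nonneg: "0 \<le> real_trunc_cost x"
  unfolding real_trunc_cost_def by (intro sum_nonneg less_imp_le kernel_pos)

lemma real_trunc_cost_ge_pair:
  assumes "i \<in> {1..N}" "j \<in> {i<..N}" shows "kernel (x i) (x j) \<le> real_trunc_cost x"
proof -
  have "kernel (x i) (x j) \<le> (\<Sum>j\<in>{i<..N}. kernel (x i) (x j))"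
    using assms(2) by (intro member_le_sum less_imp_le kernel_pos) auto
  also have "\<dots> \<le> real_trunc_cost x" unfolding real_trunc_cost_def
    using assms(1) by (intro member_le_sum sum_nonneg less_imp_le kernel_pos) auto
  finally show ?thesis .
qed

lemma trunc_cost_eq: "trunc_cost \<phi> \<alpha> N x = ennreal (real_trunc_cost x)"
proof -
  have "min (ext0 \<phi> (norm (p - q))) (ext0 \<phi> \<alpha>) = ennreal (kernel p q)" for p q :: 'a
  proof (cases "p = q")
    case False
    have "min (\<phi> (norm (p - q))) (\<phi> \<alpha>) = kernel p q"
      using False alpha phi_le[of "norm (p - q)" \<alpha>] phi_le[of \<alpha> "norm (p - q)"]
      by (auto simp: kernel_def min_def max_def)
    then show ?thesis using False alpha
      by (cases "\<phi> (norm (p - q)) \<le> \<phi> \<alpha>") (auto simp: ext0_def min_absorb1 min_absorb2 ennreal_leI)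
  qed (use alpha in \<open>simp add: ext0_def kernel_def\<close>)
  then show ?thesis
    by (simp add: trunc_cost_def pair_cost_def real_trunc_cost_def sum_ennreal sum_nonneg less_imp_le kernel_pos)
qed

lemma trunc_cost_le_cost: "trunc_cost \<phi> \<alpha> N x \<le> cost \<phi> N x"
  unfolding trunc_cost_def cost_def pair_cost_def by (intro sum_mono) auto

lemma cost_eq:
  assumes "\<And>i j. i \<in> {1..N} \<Longrightarrow> j \<in> {i<..N} \<Longrightarrow> \<alpha> \<le> norm (x i - x j)"
  shows "cost \<phi> N x = trunc_cost \<phi> \<alpha> N x"
  unfolding trunc_cost_def cost_def pair_cost_def
proof (intro sum.cong refl)
  fix i j assume "i \<in> {1..N}" "j \<in> {i<..N}"
  from assms[OF this] show "ext0 \<phi> (norm (x i - x j)) = min (ext0 \<phi> (norm (x i - x j))) (ext0 \<phi> \<alpha>)"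
    using alpha phi_le[of \<alpha> "norm (x i - x j)"]
    by (auto simp: ext0_def intro!: min_absorb1[symmetric] ennreal_leI)
qed

text \<open>Beyond \<open>T\<close> the values lie within \<open>e\<close> of the infimum of \<phi>;
  up to \<open>T + 1\<close> uniform continuity on a compact interval applies. As points closer than
  1 are compared, either both are at most \<open>T + 1\<close> or both are at least
  \<open>T\<close>.\<close>

lemma phi_max_uniform:
  assumes e: "e > 0"
  obtains \<delta> where "\<delta> > 0" "\<And>s t. \<bar>s - t\<bar> < \<delta> \<Longrightarrow> \<bar>\<phi> (max s \<alpha>) - \<phi> (max t \<alpha>)\<bar> < e"
proof -
  define l where "l = Inf (\<phi> ` {0<..})"
  have bdd: "bdd_below (\<phi> ` {0<..})" using phi_nonneg by (auto intro!: bdd_belowI2)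
  have l_le: "l \<le> \<phi> t" if "t > 0" for t
    unfolding l_def using that by (intro cInf_lower bdd) auto
  have "\<exists>y\<in>\<phi> ` {0<..}. y < l + e"
    using cInf_less_iff[of "\<phi> ` {0<..}" "l + e"] bdd e by (auto simp: l_def)
  then obtain T0 where "T0 > 0" "\<phi> T0 < l + e" by auto
  define T where "T = max T0 \<alpha>"
  have T: "T \<ge> \<alpha>" "\<And>t. t \<ge> T \<Longrightarrow> \<phi> t < l + e"
    using phi_le[OF \<open>T0 > 0\<close>] \<open>\<phi> T0 < l + e\<close> by (fastforce simp: T_def)+
  have "uniformly_continuous_on {\<alpha>..T + 1} \<phi>"
    using alpha by (intro compact_uniformly_continuous continuous_on_subset[OF phi_continuous]) auto
  then obtain \<delta> where \<delta>: "\<delta> > 0"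
    "\<And>s t. s \<in> {\<alpha>..T + 1} \<Longrightarrow> t \<in> {\<alpha>..T + 1} \<Longrightarrow> dist s t < \<delta> \<Longrightarrow> dist (\<phi> s) (\<phi> t) < e"
    using e unfolding uniformly_continuous_on_def by metis
  show thesis
  proof (rule that[of "min \<delta> 1"])
    fix s t :: real assume st: "\<bar>s - t\<bar> < min \<delta> 1"
    define s' t' where "s' = max s \<alpha>" and "t' = max t \<alpha>"
    have st': "\<bar>s' - t'\<bar> < min \<delta> 1" "s' \<ge> \<alpha>" "t' \<ge> \<alpha>" using st by (auto simp: s'_def t'_def)
    have "\<bar>\<phi> s' - \<phi> t'\<bar> < e"
    proof (cases "s' \<le> T + 1 \<and> t' \<le> T + 1")
      case True
      then show ?thesis using \<delta>(2)[of s' t'] st' by (auto simp: dist_real_def)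
    next
      case False
      then have "s' \<ge> T" "t' \<ge> T" using st' by linarith+
      then have "\<phi> s' < l + e" "\<phi> t' < l + e" "l \<le> \<phi> s'" "l \<le> \<phi> t'"
        using T(2) l_le alpha st' by auto
      then show ?thesis by linarith
    qed
    then show "\<bar>\<phi> (max s \<alpha>) - \<phi> (max t \<alpha>)\<bar> < e" by (simp add: s'_def t'_def)
  qed (use \<delta> in auto)
qed

text \<open>The uniform distance between \<open>kernel p\<close> and \<open>kernel q\<close>. It is
  a pseudometric by construction, for which an explicit modulus of continuity of \<phi> would need
  an extra argument.\<close>

definition kernel_dist :: "'a \<Rightarrow> 'a \<Rightarrow> real" where
  "kernel_dist p q = (SUP z. \<bar>kernel p z - kernel q z\<bar>)"

lemma kernel_diff_le: "\<bar>kernel p z - kernel q z\<bar> \<le> \<phi> \<alpha>"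
  using kernel_pos[of p z] kernel_pos[of q z] kernel_le[of p z] kernel_le[of q z] by linarith

lemma kernel_dist_ge: "\<bar>kernel p z - kernel q z\<bar> \<le> kernel_dist p q"
  unfolding kernel_dist_def using kernel_diff_le by (intro cSUP_upper bdd_aboveI2) auto

lemma kernel_dist_le: "(\<And>z. \<bar>kernel p z - kernel q z\<bar> \<le> b) \<Longrightarrow> kernel_dist p q \<le> b"
  unfolding kernel_dist_def by (intro cSUP_least) auto

lemma kernel_dist_nonneg: "0 \<le> kernel_dist p q"
  using kernel_dist_ge[of p undefined q] by linarith

text \<open>Extending the triangle of pairs to the full square gives every coordinate the same
  weight \<open>2 * N\<close>.\<close>

lemma real_trunc_cost_lipschitz: "real_trunc_cost x \<le> real_trunc_cost y + (\<Sum>i\<in>{1..N}. 2 * N * kernel_dist (x i) (y i))"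
proof -
  let ?e = "\<lambda>i. kernel_dist (x i) (y i)"
  have "kernel (x i) (x j) \<le> kernel (y i) (y j) + (?e i + ?e j)" for i j
    using kernel_dist_ge[of "x i" "x j" "y i"] kernel_dist_ge[of "x j" "y i" "y j"]
      kernel_commute[of "y i" "x j"] kernel_commute[of "y i" "y j"] by linarith
  then have "real_trunc_cost x \<le> (\<Sum>i\<in>{1..N}. \<Sum>j\<in>{i<..N}. kernel (y i) (y j) + (?e i + ?e j))"
    unfolding real_trunc_cost_def by (intro sum_mono)
  also have "\<dots> = real_trunc_cost y + (\<Sum>i\<in>{1..N}. \<Sum>j\<in>{i<..N}. ?e i + ?e j)"
    by (simp add: real_trunc_cost_def sum.distrib)
  also have "(\<Sum>i\<in>{1..N}. \<Sum>j\<in>{i<..N}. ?e i + ?e j) \<le> (\<Sum>i\<in>{1..N}. \<Sum>j\<in>{1..N}. ?e i + ?e j)"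
    by (intro sum_mono sum_mono2) (auto simp: kernel_dist_nonneg)
  also have "\<dots> = (\<Sum>i\<in>{1..N}. 2 * N * ?e i)"
    by (simp add: sum.distrib sum_distrib_left[symmetric])
  finally show ?thesis by simp
qed

lemma real_trunc_cost_continuous: "continuous_on UNIV real_trunc_cost"
proof -
  have "continuous_on UNIV (\<lambda>x::nat \<Rightarrow> 'a. \<phi> (max (norm (x i - x j)) \<alpha>))" for i j
    using alpha
    by (intro continuous_on_compose2[OF phi_continuous] continuous_intros
        continuous_on_product_coordinates) auto
  then show ?thesis unfolding real_trunc_cost_def kernel_def by (intro continuous_on_sum)
qed

text \<open>The last parameter has to bound both the cost, by
  \<open>N * N * \<phi> \<alpha>\<close>, and the pseudometric, by
  \<open>2 * N * \<phi> \<alpha>\<close>.\<close>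

sublocale symmetric_cost \<rho> N real_trunc_cost "\<lambda>p q. 2 * N * kernel_dist p q" "2 * N * N * \<phi> \<alpha>"
proof
  show "1 \<le> N" using N by simp
  show "sets \<rho> = sets borel" by (rule sets_rho)
  show "0 \<le> real_trunc_cost x" for x by (rule real_trunc_cost_nonneg)
  show "real_trunc_cost x \<le> 2 * N * N * \<phi> \<alpha>" for x
  proof -
    have "real_trunc_cost x \<le> (\<Sum>i\<in>{1..N}. \<Sum>j\<in>{i<..N}. \<phi> \<alpha>)"
      unfolding real_trunc_cost_def by (intro sum_mono kernel_le)
    also have "\<dots> \<le> (\<Sum>i\<in>{1..N}. \<Sum>j\<in>{1..N}. \<phi> \<alpha>)"
      using phi_pos[OF alpha] by (intro sum_mono sum_mono2) auto
    also have "\<dots> = N * N * \<phi> \<alpha>" by simp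
    also have "\<dots> \<le> 2 * N * N * \<phi> \<alpha>" using phi_pos[OF alpha] by simp
    finally show ?thesis .
  qed
  show "real_trunc_cost (restrict x {1..N}) = real_trunc_cost x" for x
    unfolding real_trunc_cost_def by (intro sum.cong refl) auto
  show "real_trunc_cost (x \<circ> \<sigma>) = real_trunc_cost x" if \<sigma>: "\<sigma> permutes {1..N}" for x \<sigma>
  proof -
    have p: "(\<Sum>i\<in>{1..N}. f (\<sigma> i)) = (\<Sum>i\<in>{1..N}. f i)" for f :: "nat \<Rightarrow> real"
      by (rule sum.reindex_bij_betw[OF permutes_imp_bij[OF \<sigma>]])
    have "(\<Sum>i\<in>{1..N}. \<Sum>j\<in>{1..N}. kernel (x (\<sigma> i)) (x (\<sigma> j))) = (\<Sum>i\<in>{1..N}. \<Sum>j\<in>{1..N}. kernel (x i) (x j))"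
      using p[of "\<lambda>j. kernel (x (\<sigma> i)) (x j)" for i] p[of "\<lambda>i. \<Sum>j\<in>{1..N}. kernel (x i) (x j)"] by simp
    then show ?thesis
      unfolding real_trunc_cost_def o_def using p[of "\<lambda>i. kernel (x i) (x i)"]
      by (subst (1 2) sum_upper_triangle) (auto intro: kernel_commute)
  qed
  show "continuous_on UNIV real_trunc_cost" by (rule real_trunc_cost_continuous)
  show "real_trunc_cost x \<le> real_trunc_cost y + (\<Sum>i\<in>{1..N}. 2 * N * kernel_dist (x i) (y i))" for x y by (rule real_trunc_cost_lipschitz)
  show "2 * N * kernel_dist p p = 0" for p by (simp add: kernel_dist_def)
  show "2 * N * kernel_dist p q = 2 * N * kernel_dist q p" for p q by (simp add: kernel_dist_def abs_minus_commute)
  show "2 * N * kernel_dist p r \<le> 2 * N * kernel_dist p q + 2 * N * kernel_dist q r" for p q r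
  proof -
    have "\<bar>kernel p z - kernel r z\<bar> \<le> kernel_dist p q + kernel_dist q r" for z
      using kernel_dist_ge[of p z q] kernel_dist_ge[of q z r] by linarith
    then have "kernel_dist p r \<le> kernel_dist p q + kernel_dist q r" by (rule kernel_dist_le)
    then have "2 * N * kernel_dist p r \<le> 2 * N * (kernel_dist p q + kernel_dist q r)" by (intro mult_left_mono) auto
    then show ?thesis by (simp add: algebra_simps)
  qed
  show "2 * N * kernel_dist p q \<le> 2 * N * N * \<phi> \<alpha>" for p q
  proof -
    have "kernel_dist p q \<le> 1 * \<phi> \<alpha>" using kernel_diff_le by (simp add: kernel_dist_le)
    also have "\<dots> \<le> N * \<phi> \<alpha>" using N phi_pos[OF alpha] by (intro mult_right_mono) auto
    finally have "2 * N * kernel_dist p q \<le> 2 * N * (N * \<phi> \<alpha>)" by (intro mult_left_mono) auto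
    then show ?thesis by (simp add: algebra_simps)
  qed
  show "\<exists>\<delta>>0. \<forall>q. dist p q < \<delta> \<longrightarrow> 2 * N * kernel_dist p q < e" if e: "e > 0" for e p
  proof -
    have "e / (4 * N) > 0" using e N by simp
    then obtain \<delta> where \<delta>: "\<delta> > 0"
      "\<And>s t. \<bar>s - t\<bar> < \<delta> \<Longrightarrow> \<bar>\<phi> (max s \<alpha>) - \<phi> (max t \<alpha>)\<bar> < e / (4 * N)"
      by (rule phi_max_uniform) blast
    have "2 * N * kernel_dist p q < e" if "dist p q < \<delta>" for q
    proof -
      have "\<bar>kernel p z - kernel q z\<bar> \<le> e / (4 * N)" for z
      proof -
        have "\<bar>norm (p - z) - norm (q - z)\<bar> \<le> norm ((p - z) - (q - z))" by (rule norm_triangle_ineq3)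
        then have "\<bar>norm (p - z) - norm (q - z)\<bar> < \<delta>" using that by (simp add: dist_norm)
        then show ?thesis unfolding kernel_def by (intro less_imp_le \<delta>(2))
      qed
      then have "kernel_dist p q \<le> e / (4 * N)" by (rule kernel_dist_le)
      then have "2 * N * kernel_dist p q \<le> 2 * N * (e / (4 * N))" by (intro mult_left_mono) auto
      also have "\<dots> < e" using e N by simp
      finally show ?thesis .
    qed
    with \<delta>(1) show ?thesis by blast
  qed
qed

lemma admissible_iff: "admissible u \<longleftrightarrow> u \<in> dual_admissible N \<rho> (trunc_cost \<phi> \<alpha> N)"
  by (simp add: admissible_def dual_admissible_def trunc_cost_eq enn2ereal_ennreal real_trunc_cost_nonneg)

end

section \<open>Separation of coordinates under an optimal plan\<close>

context truncated_repulsion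
begin

lemma real_trunc_cost_far:
  assumes "\<beta> > 0" "\<And>i j. i \<in> {1..N} \<Longrightarrow> j \<in> {i<..N} \<Longrightarrow> \<beta> \<le> norm (x i - x j)"
  shows "real_trunc_cost x \<le> N * (N - 1) / 2 * \<phi> \<beta>"
proof -
  have "real_trunc_cost x \<le> (\<Sum>i\<in>{1..N}. \<Sum>j\<in>{i<..N}. \<phi> \<beta>)"
    unfolding real_trunc_cost_def
  proof (intro sum_mono)
    fix i j assume "i \<in> {1..N}" "j \<in> {i<..N}"
    from assms(2)[OF this] show "kernel (x i) (x j) \<le> \<phi> \<beta>"
      unfolding kernel_def using assms(1) by (intro phi_le) auto
  qed
  also have "\<dots> = N * (N - 1) / 2 * \<phi> \<beta>"
    using N by (subst sum_upper_triangle) (auto simp: of_nat_diff field_simps)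
  finally show ?thesis .
qed

lemma concentration_ge: "prob (ball p r) \<le> concentration \<rho> r"
  unfolding concentration_def by (intro cSUP_upper bdd_aboveI2[where M = 1]) auto

text \<open>If a point of the good set had two coordinates closer than \<open>\<alpha>\<close>, one could choose further
  points of the good set such that distinct coordinates of distinct points are \<open>\<beta>\<close>-separated; by
  complementary slackness, rotating the coordinates among these \<open>N\<close> points does not decrease
  the total cost, which the size of \<open>\<phi> \<alpha>\<close> forbids.\<close>

lemma optimal_plan_separated:
  assumes P: "P \<in> plans N \<rho>" and int: "integrable P real_trunc_cost"
    and u: "admissible u" and le: "(\<integral>x. real_trunc_cost x \<partial>P) \<le> N * (\<integral>x. u x \<partial>\<rho>)"
    and \<beta>: "\<beta> > 0" "concentration \<rho> \<beta> < 1 / (real N * (real N - 1)\<^sup>2)"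
    and large: "(real N)\<^sup>2 * (real N - 1) / 2 * \<phi> \<beta> \<le> \<phi> \<alpha>"
  shows "AE x in P. \<forall>i\<in>{1..N}. \<forall>j\<in>{i<..N}. \<alpha> \<le> norm (x i - x j)"
proof -
  interpret P: prob_space P using P by (simp add: plans_def)
  have sP: "sets P = sets (\<Pi>\<^sub>M i\<in>{1..N}. borel)" using P by (simp add: plans_def)
  let ?U = "\<lambda>x. \<Sum>i\<in>{1..N}. u (x i)"
  have u_int: "integrable \<rho> u" using u by (simp add: admissible_def)
  note U = plans_marginal_sum[OF P sets_rho u_int]
  have U_le: "?U x \<le> real_trunc_cost x" for x by (rule admissibleD[OF u])
  have f_int: "integrable P (\<lambda>x. real_trunc_cost x - ?U x)" using int U(1) by simp
  \<comment> \<open>Complementary slackness: the integrand is nonnegative by admissibility, and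
    \<open>le\<close> makes its integral nonpositive, since \<open>?U\<close> integrates to
    \<open>N\<close> times the integral of \<open>u\<close>.\<close>
  have "(\<integral>x. real_trunc_cost x - ?U x \<partial>P) = 0"
    using le U int U_le by (intro antisym integral_nonneg_AE) (auto simp: Bochner_Integration.integral_diff[OF int U(1)])
  then have AE_eq: "AE x in P. real_trunc_cost x - ?U x = 0"
    using integral_nonneg_eq_0_iff_AE[OF f_int] U_le by simp
  define G where "G = {x\<in>space P. real_trunc_cost x - ?U x = 0}"
  have G_sets: "G \<in> sets P"
  proof -
    have "(\<lambda>x. real_trunc_cost x - ?U x) -` {0} \<inter> space P \<in> sets P"
      using borel_measurable_integrable[OF f_int] by (rule measurable_sets) simp
    then show ?thesis by (simp only: G_def vimage_def Int_def mem_Collect_eq singleton_iff conj_commute)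
  qed
  have G_prob: "P.prob G = 1"
    using AE_eq G_sets by (intro P.prob_Collect_eq_1[THEN iffD2, of "\<lambda>x. real_trunc_cost x - ?U x = 0", folded G_def])
  have proj: "(\<lambda>x. x i) \<in> measurable P borel" and marg: "distr P borel (\<lambda>x. x i) = \<rho>" if "i \<in> {1..N}" for i
    using that P by (simp_all add: measurable_cong_sets[OF sP refl] plans_def)
  have near: "{y\<in>space P. y i \<in> ball p \<beta>} \<in> sets P"
    "P.prob {y\<in>space P. y i \<in> ball p \<beta>} \<le> concentration \<rho> \<beta>" if i: "i \<in> {1..N}" for i p
  proof -
    have eq: "{y\<in>space P. y i \<in> ball p \<beta>} = (\<lambda>y. y i) -` ball p \<beta> \<inter> space P" by auto
    show "{y\<in>space P. y i \<in> ball p \<beta>} \<in> sets P"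
      unfolding eq using proj[OF i] by (rule measurable_sets) simp
    have "P.prob {y\<in>space P. y i \<in> ball p \<beta>} = measure (distr P borel (\<lambda>x. x i)) (ball p \<beta>)"
      unfolding eq using proj[OF i] by (simp add: measure_distr)
    then show "P.prob {y\<in>space P. y i \<in> ball p \<beta>} \<le> concentration \<rho> \<beta>"
      unfolding marg[OF i] using concentration_ge by simp
  qed
  have N1: "real N - 1 > 0" using N by simp
  have next_point: "\<exists>y\<in>G. \<forall>l\<in>{1..k}. \<forall>i\<in>{1..N}. \<forall>j\<in>{1..N}. i \<noteq> j \<longrightarrow> \<beta> \<le> norm (y i - xs l j)"
    if k: "k < N" for k and xs :: "nat \<Rightarrow> nat \<Rightarrow> 'a"
  proof -
    \<comment> \<open>A triple \<open>(l, i, j)\<close> stands for the event that coordinate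
      \<open>i\<close> of the new point is close to coordinate \<open>j\<close> of the
      \<open>l\<close>-th. Pairs with \<open>i = j\<close> are left out: a rotated point uses each
      coordinate index once.\<close>
    define T where "T = {1..k} \<times> (SIGMA i:{1..N}. {1..N} - {i})"
    define B where "B t = (case t of (l, i, j) \<Rightarrow> {y\<in>space P. y i \<in> ball (xs l j) \<beta>})" for t
    have fT: "finite T" by (simp add: T_def)
    have cT: "card T = k * (N * (N - 1))" by (simp add: T_def card_cartesian_product)
    have BT: "B t \<in> sets P" "P.prob (B t) \<le> concentration \<rho> \<beta>" if "t \<in> T" for t
      using that near by (auto simp: T_def B_def)
    have "P.prob (\<Union>t\<in>T. B t) \<le> (\<Sum>t\<in>T. P.prob (B t))"
      using fT BT(1) by (intro P.finite_measure_subadditive_finite) auto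
    also have "\<dots> \<le> card T * concentration \<rho> \<beta>"
      using BT(2) by (rule sum_bounded_above)
    also have "\<dots> \<le> (real N * (real N - 1)\<^sup>2) * concentration \<rho> \<beta>"
    proof (rule mult_right_mono)
      have "real k \<le> real N - 1" using k by linarith
      then have "real k * (real N * (real N - 1)) \<le> (real N - 1) * (real N * (real N - 1))"
        using N1 by (intro mult_right_mono) auto
      then show "real (card T) \<le> real N * (real N - 1)\<^sup>2"
        using N by (simp add: cT of_nat_diff power2_eq_square algebra_simps)
      show "0 \<le> concentration \<rho> \<beta>" using concentration_ge[of undefined \<beta>] measure_nonneg order.trans by blast
    qed
    also have "\<dots> < 1"
      using \<beta>(2) N1 by (simp add: less_divide_eq mult.commute split: if_splits)
    finally have less: "P.prob (\<Union>t\<in>T. B t) < P.prob G" by (simp add: G_prob)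
    have "\<not> G \<subseteq> (\<Union>t\<in>T. B t)"
    proof
      assume "G \<subseteq> (\<Union>t\<in>T. B t)"
      then have "P.prob G \<le> P.prob (\<Union>t\<in>T. B t)"
        using fT BT(1) by (intro P.finite_measure_mono) auto
      with less show False by simp
    qed
    then obtain y where y: "y \<in> G" "\<And>t. t \<in> T \<Longrightarrow> y \<notin> B t" by blast
    have "\<beta> \<le> norm (y i - xs l j)" if "l \<in> {1..k}" "i \<in> {1..N}" "j \<in> {1..N}" "i \<noteq> j" for l i j
    proof -
      have "(l, i, j) \<in> T" using that by (simp add: T_def)
      from y(2)[OF this] y(1) show ?thesis by (auto simp: B_def G_def dist_norm norm_minus_commute)
    qed
    with y(1) show ?thesis by blast
  qed
  have good: "\<alpha> \<le> norm (x i - x j)" if x: "x \<in> G" and ij: "i \<in> {1..N}" "j \<in> {i<..N}" for x i j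
  proof (rule ccontr)
    assume close: "\<not> \<alpha> \<le> norm (x i - x j)"
    have "\<exists>xs. xs 1 = x \<and> (\<forall>k\<in>{1..K}. xs k \<in> G) \<and>
      (\<forall>k\<in>{1..K}. \<forall>l\<in>{1..K}. l < k \<longrightarrow> (\<forall>i\<in>{1..N}. \<forall>j\<in>{1..N}. i \<noteq> j \<longrightarrow> \<beta> \<le> norm (xs k i - xs l j)))"
      if "1 \<le> K" "K \<le> N" for K
      using that
    proof (induction K rule: dec_induct)
      case base
      show ?case using x by (intro exI[of _ "\<lambda>_. x"]) auto
    next
      case (step K)
      then obtain xs where xs: "xs 1 = x" "\<And>k. k \<in> {1..K} \<Longrightarrow> xs k \<in> G"
        "\<And>k l i j. k \<in> {1..K} \<Longrightarrow> l \<in> {1..K} \<Longrightarrow> l < k \<Longrightarrow> i \<in> {1..N} \<Longrightarrow> j \<in> {1..N} \<Longrightarrow> i \<noteq> j \<Longrightarrow>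
          \<beta> \<le> norm (xs k i - xs l j)"
        by (metis Suc_leD)
      have "K < N" using step by simp
      from next_point[OF this, of xs] obtain y where y: "y \<in> G"
        "\<And>l i j. l \<in> {1..K} \<Longrightarrow> i \<in> {1..N} \<Longrightarrow> j \<in> {1..N} \<Longrightarrow> i \<noteq> j \<Longrightarrow> \<beta> \<le> norm (y i - xs l j)"
        by blast
      define zs where "zs = xs(Suc K := y)"
      have zs: "zs k = (if k = Suc K then y else xs k)" for k by (simp add: zs_def)
      show ?case
      proof (intro exI[of _ zs] conjI ballI impI)
        show "zs 1 = x" using step(1) xs(1) by (simp add: zs)
        show "zs k \<in> G" if "k \<in> {1..Suc K}" for k using that xs(2) y(1) by (auto simp: zs le_Suc_eq)
        fix k l i j
        assume kl: "k \<in> {1..Suc K}" "l \<in> {1..Suc K}" "l < k" and ij: "i \<in> {1..N}" "j \<in> {1..N}" "i \<noteq> j"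
        then have l: "l \<in> {1..K}" "zs l = xs l" by (auto simp: zs)
        show "\<beta> \<le> norm (zs k i - zs l j)"
        proof (cases "k = Suc K")
          case True
          then show ?thesis using y(2)[OF l(1) ij] by (simp add: l(2)) (simp add: zs)
        next
          case False
          with kl have "k \<in> {1..K}" "zs k = xs k" by (auto simp: zs)
          then show ?thesis using xs(3)[OF _ l(1) kl(3) ij] by (simp add: l(2))
        qed
      qed
    qed
    from this[of N] N obtain xs where xs: "xs 1 = x" "\<And>k. k \<in> {1..N} \<Longrightarrow> xs k \<in> G"
      "\<And>k l i j. k \<in> {1..N} \<Longrightarrow> l \<in> {1..N} \<Longrightarrow> l < k \<Longrightarrow> i \<in> {1..N} \<Longrightarrow> j \<in> {1..N} \<Longrightarrow> i \<noteq> j \<Longrightarrow>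
        \<beta> \<le> norm (xs k i - xs l j)"
      by (metis less_imp_le order_refl)
    have sep: "\<beta> \<le> norm (xs k i - xs l j)"
      if "k \<in> {1..N}" "l \<in> {1..N}" "k \<noteq> l" "i \<in> {1..N}" "j \<in> {1..N}" "i \<noteq> j" for k l i j
    proof (cases "l < k")
      case True
      then show ?thesis using xs(3) that by blast
    next
      case False
      then have "\<beta> \<le> norm (xs l j - xs k i)" using that by (intro xs(3)) auto
      then show ?thesis by (simp add: norm_minus_commute)
    qed
    \<comment> \<open>Two of the N costs are kept: the first supplies
      \<open>\<phi> \<alpha>\<close>, and the second, being positive, yields the contradiction
      although \<open>large\<close> is not strict.\<close>
    have "real_trunc_cost (xs 1) + real_trunc_cost (xs 2) = (\<Sum>k\<in>{1,2}. real_trunc_cost (xs k))" by simp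
    also have "\<dots> \<le> (\<Sum>k\<in>{1..N}. real_trunc_cost (xs k))"
      using N by (intro sum_mono2 real_trunc_cost_nonneg) auto
    also have "\<dots> = (\<Sum>k\<in>{1..N}. \<Sum>i\<in>{1..N}. u (xs k i))"
      using xs(2) by (intro sum.cong refl) (auto simp: G_def)
    also have "\<dots> = (\<Sum>i\<in>{1..N}. \<Sum>k\<in>{1..N}. u (xs k i))" by (rule sum.swap)
    \<comment> \<open>The values of \<open>u\<close> are regrouped into N new points, the
      \<open>r\<close>-th taking its coordinate \<open>i\<close> from \<open>xs (rot N r i)\<close>.
      Its distinct coordinates come from distinct points, so \<open>sep\<close> applies.\<close>
    also have "\<dots> = (\<Sum>r<N. \<Sum>i\<in>{1..N}. u (xs (rot N r i) i))"
      by (rule sum_rot[symmetric])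
    also have "\<dots> \<le> (\<Sum>r<N. N * (N - 1) / 2 * \<phi> \<beta>)"
    proof (rule sum_mono)
      fix r
      have "(\<Sum>i\<in>{1..N}. u (xs (rot N r i) i)) \<le> real_trunc_cost (\<lambda>i. xs (rot N r i) i)"
        by (rule admissibleD[OF u])
      also have "\<dots> \<le> N * (N - 1) / 2 * \<phi> \<beta>"
      proof (rule real_trunc_cost_far[OF \<beta>(1)])
        fix i j assume "i \<in> {1..N}" "j \<in> {i<..N}"
        then have ij: "i \<in> {1..N}" "j \<in> {1..N}" "i \<noteq> j" by auto
        then have "rot N r i \<noteq> rot N r j"
          using permutes_inj[OF rot_permutes[of N r]] by (auto dest: injD)
        then show "\<beta> \<le> norm (xs (rot N r i) i - xs (rot N r j) j)"
          using ij by (intro sep rot_in)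
      qed
      finally show "(\<Sum>i\<in>{1..N}. u (xs (rot N r i) i)) \<le> N * (N - 1) / 2 * \<phi> \<beta>" .
    qed
    also have "\<dots> = (real N)\<^sup>2 * (real N - 1) / 2 * \<phi> \<beta>"
      using N by (simp add: of_nat_diff power2_eq_square)
    also have "\<dots> \<le> \<phi> \<alpha>" by (rule large)
    also have "\<phi> \<alpha> = kernel (x i) (x j)" using close by (simp add: kernel_def)
    also have "\<dots> \<le> real_trunc_cost (xs 1)" unfolding xs(1) using ij by (rule real_trunc_cost_ge_pair)
    finally have "real_trunc_cost (xs 2) \<le> 0" by simp
    moreover have "kernel (xs 2 1) (xs 2 2) \<le> real_trunc_cost (xs 2)" using N by (intro real_trunc_cost_ge_pair) auto
    ultimately show False using kernel_pos[of "xs 2 1" "xs 2 2"] by linarith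
  qed
  have "AE x in P. x \<in> G" using AE_eq by (simp add: G_def AE_iff_measurable)
  then show ?thesis
    using good by (auto elim!: eventually_mono)
qed

text \<open>The plan lives where both costs coincide, so its original cost is at most the dual value
  of \<open>u\<close>. As \<open>u\<close> is also admissible for the original cost, weak duality
  gives the converse.\<close>

lemma separated_duality:
  assumes \<beta>: "\<beta> > 0" "concentration \<rho> \<beta> < 1 / (real N * (real N - 1)\<^sup>2)"
    and large: "(real N)\<^sup>2 * (real N - 1) / 2 * \<phi> \<beta> \<le> \<phi> \<alpha>"
  obtains P u where "P \<in> plans N \<rho>" "u \<in> dual_admissible N \<rho> (trunc_cost \<phi> \<alpha> N)"
    "enn2ereal (\<integral>\<^sup>+x. cost \<phi> N x \<partial>P) = ereal (N * (\<integral>x. u x \<partial>\<rho>))"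
proof -
  obtain u P where u: "admissible u" and P: "P \<in> plans N \<rho>" "integrable P real_trunc_cost"
    "(\<integral>x. real_trunc_cost x \<partial>P) \<le> N * (\<integral>x. u x \<partial>\<rho>)"
    using duality by blast
  have "AE x in P. cost \<phi> N x = ennreal (real_trunc_cost x)"
    using optimal_plan_separated[OF P(1,2) u P(3) \<beta> large]
    by (auto elim!: eventually_mono simp: trunc_cost_eq[symmetric] intro: cost_eq)
  then have "(\<integral>\<^sup>+x. cost \<phi> N x \<partial>P) = (\<integral>\<^sup>+x. ennreal (real_trunc_cost x) \<partial>P)"
    by (rule nn_integral_cong_AE)
  also have "\<dots> = ennreal (\<integral>x. real_trunc_cost x \<partial>P)"
    using P(2) real_trunc_cost_nonneg by (intro nn_integral_eq_integral) auto
  finally have eq: "enn2ereal (\<integral>\<^sup>+x. cost \<phi> N x \<partial>P) = ereal (\<integral>x. real_trunc_cost x \<partial>P)"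
    using real_trunc_cost_nonneg by (simp add: enn2ereal_ennreal integral_nonneg_AE)
  have u': "u \<in> dual_admissible N \<rho> (trunc_cost \<phi> \<alpha> N)" using u by (simp add: admissible_iff)
  have "u \<in> dual_admissible N \<rho> (cost \<phi> N)"
    using u' trunc_cost_le_cost by (auto simp: dual_admissible_def less_eq_ennreal.rep_eq intro: order.trans)
  from weak_duality[OF P(1) sets_rho this] eq P(3)
  have "enn2ereal (\<integral>\<^sup>+x. cost \<phi> N x \<partial>P) = ereal (N * (\<integral>x. u x \<partial>\<rho>))" by simp
  with P(1) u' show thesis by (rule that)
qed

end

section \<open>Return to the original cost\<close>

theorem theorem2p6:
  fixes N :: nat and \<phi> :: "real \<Rightarrow> real" and \<rho> :: "(real ^ 'd) measure" and L :: real
  assumes "N > 1"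
    and "continuous_on {0<..} \<phi>"
    and "strict_antimono_on {0<..} \<phi>"
    and "\<And>t. t > 0 \<Longrightarrow> \<phi> t \<ge> 0"
    and "filterlim \<phi> at_top (at_right 0)"
    and "prob_space \<rho>" and "sets \<rho> = sets borel"
    and "(concentration \<rho> \<longlongrightarrow> L) (at_right 0)"
    and "L < 1 / (real N * (real N - 1)\<^sup>2)"
  shows "(\<exists>P\<in>plans N \<rho>. (\<integral>\<^sup>+x. cost \<phi> N x \<partial>P) = transport_cost N \<rho> (cost \<phi> N)) \<and>
    (\<exists>u. kantorovich_potential N \<rho> (cost \<phi> N) u \<and>
       enn2ereal (transport_cost N \<rho> (cost \<phi> N)) = ereal (real N * (\<integral>x. u x \<partial>\<rho>))) \<and>
    (\<forall>\<beta> \<alpha> u. \<beta> > 0 \<and> concentration \<rho> \<beta> < 1 / (real N * (real N - 1)\<^sup>2) \<and>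
       0 < \<alpha> \<and> \<alpha> \<le> inv_into {0<..} \<phi> ((real N)\<^sup>2 * (real N - 1) / 2 * \<phi> \<beta>) \<and>
       kantorovich_potential N \<rho> (trunc_cost \<phi> \<alpha> N) u \<longrightarrow>
       kantorovich_potential N \<rho> (cost \<phi> N) u)"
proof -
  let ?A = "(real N)\<^sup>2 * (real N - 1) / 2"
  have anti: "\<phi> t < \<phi> s" if "0 < s" "s < t" for s t
    using assms(3) that by (auto simp: monotone_on_def)
  have A1: "?A \<ge> 1"
  proof -
    have "2 * 2 * 1 \<le> real N * real N * (real N - 1)"
      using assms(1) by (intro mult_mono) auto
    then show ?thesis by (simp add: power2_eq_square)
  qed
  \<comment> \<open>The value of \<open>inv_into\<close> is meaningful only if the level is
    attained. It is at least \<open>\<phi> \<beta>\<close> because \<open>?A \<ge> 1\<close>, and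
    \<phi> exceeds it near 0, so the intermediate value theorem applies.\<close>
  have level: "\<exists>a>0. \<phi> a = ?A * \<phi> \<beta>" if \<beta>: "\<beta> > 0" for \<beta>
  proof -
    have ge: "\<phi> \<beta> \<le> ?A * \<phi> \<beta>" using mult_right_mono[OF A1 assms(4)[OF \<beta>]] by simp
    have "eventually (\<lambda>t. ?A * \<phi> \<beta> \<le> \<phi> t) (at_right 0)"
      using assms(5) unfolding filterlim_at_top by blast
    moreover have "eventually (\<lambda>t. t < \<beta>) (at_right 0)" "eventually (\<lambda>t. 0 < t) (at_right (0::real))"
      using \<beta> by (auto simp: eventually_at_right_less intro: eventually_at_right_field[THEN iffD2])
    ultimately have "eventually (\<lambda>t. ?A * \<phi> \<beta> \<le> \<phi> t \<and> t < \<beta> \<and> 0 < t) (at_right 0)"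
      by eventually_elim auto
    then obtain s where s: "?A * \<phi> \<beta> \<le> \<phi> s" "s < \<beta>" "0 < s"
      using eventually_happens trivial_limit_at_right_real by blast
    have "\<exists>a\<ge>s. a \<le> \<beta> \<and> \<phi> a = ?A * \<phi> \<beta>"
      using s ge assms(2) by (intro IVT2') (auto intro: continuous_on_subset)
    with s(3) show ?thesis by (auto intro: order.strict_trans2)
  qed
  have phi_inv: "?A * \<phi> \<beta> \<le> \<phi> \<alpha>"
    if "\<beta> > 0" "0 < \<alpha>" "\<alpha> \<le> inv_into {0<..} \<phi> (?A * \<phi> \<beta>)" for \<alpha> \<beta>
  proof -
    have "?A * \<phi> \<beta> \<in> \<phi> ` {0<..}" using level[OF that(1)] by (metis greaterThan_iff image_eqI)
    then have "\<phi> (inv_into {0<..} \<phi> (?A * \<phi> \<beta>)) = ?A * \<phi> \<beta>" by (rule f_inv_into_f)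
    then show ?thesis using anti[OF that(2), of "inv_into {0<..} \<phi> (?A * \<phi> \<beta>)"] that(3)
      by (cases "\<alpha> = inv_into {0<..} \<phi> (?A * \<phi> \<beta>)") auto
  qed
  have trunc: "truncated_repulsion \<rho> N \<phi> \<alpha>" if "\<alpha> > 0" for \<alpha>
    using assms that unfolding truncated_repulsion_def truncated_repulsion_axioms_def by blast
  have core: "\<exists>P u. P \<in> plans N \<rho> \<and> u \<in> dual_admissible N \<rho> (trunc_cost \<phi> \<alpha> N) \<and>
      enn2ereal (\<integral>\<^sup>+x. cost \<phi> N x \<partial>P) = ereal (N * (\<integral>x. u x \<partial>\<rho>))"
    if "\<alpha> > 0" "\<beta> > 0" "concentration \<rho> \<beta> < 1 / (real N * (real N - 1)\<^sup>2)" "?A * \<phi> \<beta> \<le> \<phi> \<alpha>" for \<alpha> \<beta>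
    using truncated_repulsion.separated_duality[OF trunc[OF that(1)] that(2-4)] by metis
  have adm: "dual_admissible N \<rho> (trunc_cost \<phi> \<alpha> N) \<subseteq> dual_admissible N \<rho> (cost \<phi> N)" if "\<alpha> > 0" for \<alpha>
    using truncated_repulsion.trunc_cost_le_cost[OF trunc[OF that]]
    by (auto simp: dual_admissible_def less_eq_ennreal.rep_eq intro: order.trans)
  have "eventually (\<lambda>r. concentration \<rho> r < 1 / (real N * (real N - 1)\<^sup>2)) (at_right 0)"
    using assms(8,9) by (rule order_tendstoD)
  moreover have "eventually (\<lambda>r. 0 < r) (at_right (0::real))" by (rule eventually_at_right_less)
  ultimately have "eventually (\<lambda>r. concentration \<rho> r < 1 / (real N * (real N - 1)\<^sup>2) \<and> 0 < r) (at_right 0)"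
    by eventually_elim auto
  then obtain \<beta> where \<beta>: "concentration \<rho> \<beta> < 1 / (real N * (real N - 1)\<^sup>2)" "\<beta> > 0"
    using eventually_happens trivial_limit_at_right_real by blast
  obtain \<alpha> where \<alpha>: "\<alpha> > 0" "\<phi> \<alpha> = ?A * \<phi> \<beta>" using level[OF \<beta>(2)] by auto
  obtain P u where P: "P \<in> plans N \<rho>" and u: "u \<in> dual_admissible N \<rho> (trunc_cost \<phi> \<alpha> N)"
    and eq: "enn2ereal (\<integral>\<^sup>+x. cost \<phi> N x \<partial>P) = ereal (N * (\<integral>x. u x \<partial>\<rho>))"
    using core[OF \<alpha>(1) \<beta>(2,1)] \<alpha>(2) by auto
  have u_cost: "u \<in> dual_admissible N \<rho> (cost \<phi> N)" using u adm[OF \<alpha>(1)] by blast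
  have opt: "(\<integral>\<^sup>+x. cost \<phi> N x \<partial>P) = transport_cost N \<rho> (cost \<phi> N)"
  proof (rule antisym)
    show "(\<integral>\<^sup>+x. cost \<phi> N x \<partial>P) \<le> transport_cost N \<rho> (cost \<phi> N)"
      unfolding transport_cost_def
    proof (rule INF_greatest)
      fix P' assume "P' \<in> plans N \<rho>"
      from weak_duality[OF this assms(7) u_cost] show "(\<integral>\<^sup>+x. cost \<phi> N x \<partial>P) \<le> (\<integral>\<^sup>+x. cost \<phi> N x \<partial>P')"
        by (simp add: less_eq_ennreal.rep_eq eq)
    qed
    show "transport_cost N \<rho> (cost \<phi> N) \<le> (\<integral>\<^sup>+x. cost \<phi> N x \<partial>P)"
      unfolding transport_cost_def using P by (rule INF_lower)
  qed
  \<comment> \<open>An optimality certificate: by weak duality, no admissible function can beat one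
    whose dual value reaches the cost of some plan.\<close>
  have potential: "kantorovich_potential N \<rho> (cost \<phi> N) w"
    if "w \<in> dual_admissible N \<rho> (cost \<phi> N)" "P' \<in> plans N \<rho>"
      "enn2ereal (\<integral>\<^sup>+x. cost \<phi> N x \<partial>P') \<le> ereal (N * (\<integral>x. w x \<partial>\<rho>))" for w P'
    unfolding kantorovich_potential_def
  proof (intro conjI ballI that(1))
    fix v assume "v \<in> dual_admissible N \<rho> (cost \<phi> N)"
    from order.trans[OF weak_duality[OF that(2) assms(7) this] that(3)]
    show "real N * (\<integral>x. v x \<partial>\<rho>) \<le> real N * (\<integral>x. w x \<partial>\<rho>)" by simp
  qed
  show ?thesis
  proof (intro conjI allI impI)
    show "\<exists>P\<in>plans N \<rho>. (\<integral>\<^sup>+x. cost \<phi> N x \<partial>P) = transport_cost N \<rho> (cost \<phi> N)"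
      using P opt by blast
    show "\<exists>u. kantorovich_potential N \<rho> (cost \<phi> N) u \<and>
       enn2ereal (transport_cost N \<rho> (cost \<phi> N)) = ereal (real N * (\<integral>x. u x \<partial>\<rho>))"
      using potential[OF u_cost P] eq opt by auto
    fix \<beta> \<alpha> w
    assume *: "\<beta> > 0 \<and> concentration \<rho> \<beta> < 1 / (real N * (real N - 1)\<^sup>2) \<and>
       0 < \<alpha> \<and> \<alpha> \<le> inv_into {0<..} \<phi> (?A * \<phi> \<beta>) \<and>
       kantorovich_potential N \<rho> (trunc_cost \<phi> \<alpha> N) w"
    then have "?A * \<phi> \<beta> \<le> \<phi> \<alpha>" using phi_inv by blast
    then obtain P' u' where P': "P' \<in> plans N \<rho>" and u': "u' \<in> dual_admissible N \<rho> (trunc_cost \<phi> \<alpha> N)"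
      and eq': "enn2ereal (\<integral>\<^sup>+x. cost \<phi> N x \<partial>P') = ereal (N * (\<integral>x. u' x \<partial>\<rho>))"
      using core[of \<alpha> \<beta>] * by blast
    \<comment> \<open>As a maximizer for the truncated cost, \<open>w\<close> does at least as well
      as \<open>u'\<close>, whose dual value is the original cost of \<open>P'\<close>; this is the
      certificate required by \<open>potential\<close>.\<close>
    have w: "w \<in> dual_admissible N \<rho> (trunc_cost \<phi> \<alpha> N)"
      "real N * (\<integral>x. u' x \<partial>\<rho>) \<le> real N * (\<integral>x. w x \<partial>\<rho>)"
      using * u' unfolding kantorovich_potential_def by blast+
    show "kantorovich_potential N \<rho> (cost \<phi> N) w"
      using w adm[of \<alpha>] * eq' by (intro potential[OF _ P']) auto
  qed
qed

end
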